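(* Let $n\in\{4,5\}$ and fix any total order on the set of pairs $\{(i,j):1\le i<j\le n\}$. Then the ordered monomials $\prod_{i<j}O_{ij}^{m_{ij}}$ (product taken in the fixed order), where $m=(m_{ij})_{1\le i<j\le n}$ ranges over all uncrossable diagrams on $n$ vertices, form a linear basis of the subalgebra of $\mathcal{W}\otimes\mathcal{C}$ generated by $\{O_{ij}:1\le i<j\le n\}$.
   Context: $\mathcal{W}$ is the Weyl algebra over $\mathbb{C}$ with generators $x_1,\dots,x_n,y_1,\dots,y_n$ and relations $[y_i,x_j]=\delta_{ij}$, $[x_i,x_j]=[y_i,y_j]=0$. $\mathcal{C}$ is the Clifford algebra over $\mathbb{C}$ with generators $e_1,\dots,e_n$ and relations $e_ie_j+e_je_i=2\delta_{ij}$. $\mathcal{W}\otimes\mathcal{C}$ is the ordinary tensor product of algebras. For $i\ne j$, $O_{ij}=x_iy_j-x_jy_i+\frac12e_ie_j\in\mathcal{W}\otimes\mathcal{C}$. A (TAMA) diagram on $n$ vertices is a family $m=(m_{ij})_{1\le i<j\le n}$ of nonnegative integers, viewed as the multiset of chords of a regular $n$-gon with vertices $1,\dots,n$ in which the chord $(i,j)$ has multiplicity $m_{ij}$. A diagram is crossed if there exist $i<j<k<l$ with $m_{ik}\ge1$ and $m_{jl}\ge1$, and uncrossed otherwise. A diagram $D$ is uncrossable if either $D$ is uncrossed or $D=D'\cup(i,j)$ for some uncrossed diagram $D'$ and some chord $(i,j)$, i.e. $D$ is obtained from $D'$ by increasing a single multiplicity by $1$. *)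

theory Defs
  imports Complex_Main "HOL-Library.Poly_Mapping" "HOL-Library.Multiset"
begin

section \<open>Complex algebras\<close>

text \<open>
  Associative unital algebras over the complex numbers. The class is built on \<^class>\<open>ring\<close> and
  \<^class>\<open>monoid_mult\<close> rather than \<^class>\<open>ring_1\<close>, because the latter demands \<open>0 \<noteq> 1\<close>, which for
  an algebra given by generators and relations is a theorem and not part of the construction.
\<close>

class complex_algebra = ring + monoid_mult +
  fixes cscale :: "complex \<Rightarrow> 'a \<Rightarrow> 'a"  (infixr \<open>*\<^sub>C\<close> 75)
  assumes cscale_add_right: "c *\<^sub>C (x + y) = c *\<^sub>C x + c *\<^sub>C y"
    and cscale_add_left: "(c + d) *\<^sub>C x = c *\<^sub>C x + d *\<^sub>C x"
    and cscale_cscale: "c *\<^sub>C d *\<^sub>C x = (c * d) *\<^sub>C x"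
    and cscale_one: "1 *\<^sub>C x = x"
    and cscale_mult_left: "(c *\<^sub>C x) * y = c *\<^sub>C (x * y)"
    and cscale_mult_right: "x * (c *\<^sub>C y) = c *\<^sub>C (x * y)"

global_interpretation cvec: vector_space "cscale :: complex \<Rightarrow> 'a \<Rightarrow> 'a::complex_algebra"
  by unfold_locales
    (simp_all add: cscale_add_right cscale_add_left cscale_cscale cscale_one)

inductive_set generated_subalgebra :: "'a::complex_algebra set \<Rightarrow> 'a set" for S where
  gen: "s \<in> S \<Longrightarrow> s \<in> generated_subalgebra S"
| one: "1 \<in> generated_subalgebra S"
| add: "a \<in> generated_subalgebra S \<Longrightarrow> b \<in> generated_subalgebra S \<Longrightarrow>
    a + b \<in> generated_subalgebra S"
| mult: "a \<in> generated_subalgebra S \<Longrightarrow> b \<in> generated_subalgebra S \<Longrightarrow>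
    a * b \<in> generated_subalgebra S"
| scale: "a \<in> generated_subalgebra S \<Longrightarrow> c *\<^sub>C a \<in> generated_subalgebra S"


section \<open>Free algebras and two-sided ideals\<close>

text \<open>
  \<^typ>\<open>'m \<Rightarrow>\<^sub>0 complex\<close> is the monoid algebra of a monoid \<^typ>\<open>'m\<close> that is written additively (but
  need not be commutative). Taking the monoid of words gives the free algebra.
\<close>

datatype 'g free_monoid = Word "'g list"

instantiation free_monoid :: (type) monoid_add
begin

definition zero_free_monoid :: "'a free_monoid" where
  "0 = Word []"

fun plus_free_monoid :: "'a free_monoid \<Rightarrow> 'a free_monoid \<Rightarrow> 'a free_monoid" where
  "Word u + Word v = Word (u @ v)"

instance
proof
  fix a b c :: "'a free_monoid"
  show "a + b + c = a + (b + c)" by (cases a; cases b; cases c) simp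
  show "0 + a = a" by (cases a) (simp add: zero_free_monoid_def)
  show "a + 0 = a" by (cases a) (simp add: zero_free_monoid_def)
qed

end

type_synonym 'g free_algebra = "'g free_monoid \<Rightarrow>\<^sub>0 complex"

definition gvar :: "'g \<Rightarrow> 'g free_algebra" where
  "gvar g = Poly_Mapping.single (Word [g]) 1"

definition pm_scale :: "complex \<Rightarrow> ('m::monoid_add \<Rightarrow>\<^sub>0 complex) \<Rightarrow> ('m \<Rightarrow>\<^sub>0 complex)" where
  "pm_scale c p = Poly_Mapping.single 0 c * p"

lemma pm_single_sum: "p = (\<Sum>k\<in>Poly_Mapping.keys p. Poly_Mapping.single k (Poly_Mapping.lookup p k))"
  by (rule poly_mapping_eqI)
    (auto simp: lookup_sum lookup_single when_def sum.delta' in_keys_iff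
      intro!: sum.neutral[symmetric])

lemma pm_induct [case_names zero add]:
  fixes p :: "'m \<Rightarrow>\<^sub>0 'v::comm_monoid_add"
  assumes "P 0" and "\<And>k v q. P q \<Longrightarrow> P (Poly_Mapping.single k v + q)"
  shows "P p"
proof -
  have "P (\<Sum>k\<in>A. Poly_Mapping.single k (Poly_Mapping.lookup p k))" if "finite A" for A
    using that by (induction A rule: finite_induct) (simp_all add: assms)
  from this[OF finite_keys] show ?thesis
    using pm_single_sum[of p] by metis
qed

lemma pm_scale_single: "pm_scale c (Poly_Mapping.single k v) = Poly_Mapping.single k (c * v)"
  by (simp add: pm_scale_def mult_single)

lemma pm_scale_add_right: "pm_scale c (p + q) = pm_scale c p + pm_scale c q"
  by (simp add: pm_scale_def distrib_left)

lemma pm_scale_zero_right: "pm_scale c 0 = 0"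
  by (simp add: pm_scale_def)

lemma lookup_pm_scale: "Poly_Mapping.lookup (pm_scale c p) k = c * Poly_Mapping.lookup p k"
  by (induction p rule: pm_induct)
    (auto simp: pm_scale_add_right pm_scale_single pm_scale_zero_right lookup_add lookup_single
      when_def distrib_left)

lemma pm_scale_central: "Poly_Mapping.single 0 c * p = p * Poly_Mapping.single 0 (c::complex)"
  by (induction p rule: pm_induct) (simp_all add: distrib_left distrib_right mult_single mult.commute)

lemma pm_scale_diff_right: "pm_scale c (p - q) = pm_scale c p - pm_scale c q"
  by (simp add: pm_scale_def right_diff_distrib)

lemma pm_scale_add_left: "pm_scale (c + d) p = pm_scale c p + pm_scale d p"
  by (simp add: pm_scale_def single_add distrib_right)

lemma pm_scale_scale: "pm_scale c (pm_scale d p) = pm_scale (c * d) p"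
  by (simp add: pm_scale_def mult_single mult.assoc[symmetric])

lemma pm_scale_one: "pm_scale 1 p = p"
  by (simp add: pm_scale_def)

lemma pm_scale_mult_left: "pm_scale c p * q = pm_scale c (p * q)"
  by (simp add: pm_scale_def mult.assoc)

lemma pm_scale_mult_right: "p * pm_scale c q = pm_scale c (p * q)"
  by (metis pm_scale_central pm_scale_def mult.assoc)

global_interpretation pm: vector_space "pm_scale :: complex \<Rightarrow> ('m::monoid_add \<Rightarrow>\<^sub>0 complex) \<Rightarrow> _"
  by unfold_locales
    (simp_all add: pm_scale_add_right pm_scale_add_left pm_scale_scale pm_scale_one)

inductive_set generated_ideal :: "'a::ring_1 set \<Rightarrow> 'a set" for S where
  gen: "s \<in> S \<Longrightarrow> s \<in> generated_ideal S"
| zero: "0 \<in> generated_ideal S"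
| add: "a \<in> generated_ideal S \<Longrightarrow> b \<in> generated_ideal S \<Longrightarrow> a + b \<in> generated_ideal S"
| lmult: "a \<in> generated_ideal S \<Longrightarrow> p * a \<in> generated_ideal S"
| rmult: "a \<in> generated_ideal S \<Longrightarrow> a * p \<in> generated_ideal S"

locale two_sided_ideal =
  fixes I :: "'a::ring_1 set"
  assumes zero: "0 \<in> I"
    and add: "a \<in> I \<Longrightarrow> b \<in> I \<Longrightarrow> a + b \<in> I"
    and lmult: "a \<in> I \<Longrightarrow> p * a \<in> I"
    and rmult: "a \<in> I \<Longrightarrow> a * p \<in> I"
begin

lemma uminus: "a \<in> I \<Longrightarrow> - a \<in> I"
  using lmult[of a "-1"] by simp

lemma cong_equivp: "equivp (\<lambda>p q. p - q \<in> I)"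
proof (rule equivpI)
  show "reflp (\<lambda>p q. p - q \<in> I)" by (simp add: reflp_def zero)
  show "symp (\<lambda>p q. p - q \<in> I)"
    by (rule sympI) (metis uminus minus_diff_eq)
  show "transp (\<lambda>p q. p - q \<in> I)"
  proof (rule transpI)
    fix p q r assume "p - q \<in> I" "q - r \<in> I"
    from add[OF this] show "p - r \<in> I" by simp
  qed
qed

lemma cong_add: "p - p' \<in> I \<Longrightarrow> q - q' \<in> I \<Longrightarrow> (p + q) - (p' + q') \<in> I"
  using add[of "p - p'" "q - q'"] by (simp add: algebra_simps)

lemma cong_uminus: "p - p' \<in> I \<Longrightarrow> (- p) - (- p') \<in> I"
  using uminus[of "p - p'"] by (simp add: algebra_simps)

lemma cong_diff: "p - p' \<in> I \<Longrightarrow> q - q' \<in> I \<Longrightarrow> (p - q) - (p' - q') \<in> I"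
  using cong_add[OF _ cong_uminus, of p p' q q'] by simp

lemma cong_mult:
  assumes "p - p' \<in> I" "q - q' \<in> I"
  shows "p * q - p' * q' \<in> I"
proof -
  have "(p - p') * q + p' * (q - q') \<in> I"
    using assms by (intro add lmult rmult)
  then show ?thesis by (simp add: algebra_simps)
qed

end

lemma two_sided_ideal_generated: "two_sided_ideal (generated_ideal S)"
  by unfold_locales (auto intro: generated_ideal.intros)

lemma two_sided_ideal_cong_pm_scale:
  assumes "two_sided_ideal I" "p - q \<in> I"
  shows "pm_scale c p - pm_scale c q \<in> I"
  using two_sided_ideal.lmult[OF assms] by (simp add: pm_scale_def right_diff_distrib)


section \<open>The Weyl algebra\<close>

text \<open>
  The generators are indexed by a type \<^typ>\<open>'n\<close>; the algebra on \<open>n\<close> pairs of generators is the case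
  in which that type has \<open>n\<close> elements.
\<close>

datatype 'n weyl_gen = X 'n | Y 'n

definition weyl_relators :: "'n weyl_gen free_algebra set" where
  "weyl_relators =
     {gvar (Y i) * gvar (X j) - gvar (X j) * gvar (Y i) - (if i = j then 1 else 0) | i j. True} \<union>
     {gvar (X i) * gvar (X j) - gvar (X j) * gvar (X i) | i j. True} \<union>
     {gvar (Y i) * gvar (Y j) - gvar (Y j) * gvar (Y i) | i j. True}"

interpretation weyl_ideal: two_sided_ideal "generated_ideal weyl_relators"
  by (rule two_sided_ideal_generated)

quotient_type (overloaded) 'n weyl = "'n weyl_gen free_algebra" /
  "\<lambda>p q. p - q \<in> generated_ideal weyl_relators"
  by (rule weyl_ideal.cong_equivp)

instantiation weyl :: (type) complex_algebra
begin

lift_definition zero_weyl :: "'a weyl" is 0 .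
lift_definition one_weyl :: "'a weyl" is 1 .
lift_definition plus_weyl :: "'a weyl \<Rightarrow> 'a weyl \<Rightarrow> 'a weyl" is "(+)"
  by (rule weyl_ideal.cong_add)
lift_definition minus_weyl :: "'a weyl \<Rightarrow> 'a weyl \<Rightarrow> 'a weyl" is "(-)"
  by (rule weyl_ideal.cong_diff)
lift_definition uminus_weyl :: "'a weyl \<Rightarrow> 'a weyl" is uminus
  by (rule weyl_ideal.cong_uminus)
lift_definition times_weyl :: "'a weyl \<Rightarrow> 'a weyl \<Rightarrow> 'a weyl" is "(*)"
  by (rule weyl_ideal.cong_mult)
lift_definition cscale_weyl :: "complex \<Rightarrow> 'a weyl \<Rightarrow> 'a weyl" is pm_scale
  by (rule two_sided_ideal_cong_pm_scale[OF two_sided_ideal_generated])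

instance
  by standard
    (transfer; simp add: algebra_simps weyl_ideal.zero pm_scale_add_right pm_scale_add_left
      pm_scale_scale pm_scale_one pm_scale_mult_left pm_scale_mult_right)+

end

lift_definition weyl_x :: "'n \<Rightarrow> 'n weyl" is "\<lambda>i. gvar (X i)" .
lift_definition weyl_y :: "'n \<Rightarrow> 'n weyl" is "\<lambda>i. gvar (Y i)" .


section \<open>The Clifford algebra\<close>

definition clifford_relators :: "'n free_algebra set" where
  "clifford_relators =
     {gvar i * gvar j + gvar j * gvar i - (if i = j then 2 else 0) | i j. True}"

interpretation clifford_ideal: two_sided_ideal "generated_ideal clifford_relators"
  by (rule two_sided_ideal_generated)

quotient_type (overloaded) 'n clifford = "'n free_algebra" /
  "\<lambda>p q. p - q \<in> generated_ideal clifford_relators"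
  by (rule clifford_ideal.cong_equivp)

instantiation clifford :: (type) complex_algebra
begin

lift_definition zero_clifford :: "'a clifford" is 0 .
lift_definition one_clifford :: "'a clifford" is 1 .
lift_definition plus_clifford :: "'a clifford \<Rightarrow> 'a clifford \<Rightarrow> 'a clifford" is "(+)"
  by (rule clifford_ideal.cong_add)
lift_definition minus_clifford :: "'a clifford \<Rightarrow> 'a clifford \<Rightarrow> 'a clifford" is "(-)"
  by (rule clifford_ideal.cong_diff)
lift_definition uminus_clifford :: "'a clifford \<Rightarrow> 'a clifford" is uminus
  by (rule clifford_ideal.cong_uminus)
lift_definition times_clifford :: "'a clifford \<Rightarrow> 'a clifford \<Rightarrow> 'a clifford" is "(*)"
  by (rule clifford_ideal.cong_mult)
lift_definition cscale_clifford :: "complex \<Rightarrow> 'a clifford \<Rightarrow> 'a clifford" is pm_scale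
  by (rule two_sided_ideal_cong_pm_scale[OF two_sided_ideal_generated])

instance
  by standard
    (transfer; simp add: algebra_simps clifford_ideal.zero pm_scale_add_right pm_scale_add_left
      pm_scale_scale pm_scale_one pm_scale_mult_left pm_scale_mult_right)+

end

lift_definition clifford_e :: "'n \<Rightarrow> 'n clifford" is gvar .


section \<open>The tensor product of two algebras\<close>

text \<open>
  \<open>A \<otimes> B\<close> is the free complex vector space on the set \<open>A \<times> B\<close> modulo the span of the bilinearity
  relators, with \<open>(a \<otimes> b) (a' \<otimes> b') = aa' \<otimes> bb'\<close>. The type below is \<open>A \<times> B\<close> with its componentwise
  multiplication written additively, so that the free vector space on it carries the convolution
  product of \<^theory>\<open>HOL-Library.Poly_Mapping\<close>.
\<close>

datatype ('a, 'b) prod_monoid = Pr 'a 'b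

instantiation prod_monoid :: (monoid_mult, monoid_mult) monoid_add
begin

definition zero_prod_monoid :: "('a, 'b) prod_monoid" where
  "0 = Pr 1 1"

fun plus_prod_monoid :: "('a, 'b) prod_monoid \<Rightarrow> ('a, 'b) prod_monoid \<Rightarrow> ('a, 'b) prod_monoid" where
  "Pr a b + Pr a' b' = Pr (a * a') (b * b')"

instance
proof
  fix a b c :: "('a, 'b) prod_monoid"
  show "a + b + c = a + (b + c)" by (cases a; cases b; cases c) (simp add: mult.assoc)
  show "0 + a = a" by (cases a) (simp add: zero_prod_monoid_def)
  show "a + 0 = a" by (cases a) (simp add: zero_prod_monoid_def)
qed

end

definition pure :: "'a \<Rightarrow> 'b \<Rightarrow> ('a, 'b) prod_monoid \<Rightarrow>\<^sub>0 complex" where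
  "pure a b = Poly_Mapping.single (Pr a b) 1"

definition bilinear_relators ::
    "(('a::complex_algebra, 'b::complex_algebra) prod_monoid \<Rightarrow>\<^sub>0 complex) set" where
  "bilinear_relators =
     {pure (a + a') b - pure a b - pure a' b | a a' b. True} \<union>
     {pure a (b + b') - pure a b - pure a b' | a b b'. True} \<union>
     {pure (c *\<^sub>C a) b - pm_scale c (pure a b) | c a b. True} \<union>
     {pure a (c *\<^sub>C b) - pm_scale c (pure a b) | c a b. True}"

lemma pure_mult: "pure a b * pure a' b' = pure (a * a') (b * b')"
  by (simp add: pure_def mult_single)

lemma single_eq_pm_scale_pure: "Poly_Mapping.single (Pr a b) v = pm_scale v (pure a b)"
  by (simp add: pure_def pm_scale_single)

lemma pure_mult_bilinear_relators:
  assumes "r \<in> bilinear_relators"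
  shows "pure a b * r \<in> bilinear_relators" "r * pure a b \<in> bilinear_relators"
proof -
  have "pure a b * r \<in> bilinear_relators \<and> r * pure a b \<in> bilinear_relators"
    using assms unfolding bilinear_relators_def
    apply (elim UnE CollectE exE conjE)
       apply (simp_all only: right_diff_distrib left_diff_distrib pure_mult pm_scale_mult_left
          pm_scale_mult_right cscale_mult_left cscale_mult_right distrib_left distrib_right)
       apply blast+
    done
  then show "pure a b * r \<in> bilinear_relators" "r * pure a b \<in> bilinear_relators" by auto
qed

lemma mult_span_bilinear_relators:
  assumes "r \<in> pm.span bilinear_relators"
  shows "p * r \<in> pm.span bilinear_relators" "r * p \<in> pm.span bilinear_relators"
proof -
  have pure: "pure a b * r \<in> pm.span bilinear_relators \<and> r * pure a b \<in> pm.span bilinear_relators"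
    for a :: 'a and b :: 'b
    using assms
  proof (induction rule: pm.span_induct_alt)
    case base
    then show ?case by (simp add: pm.span_zero)
  next
    case (step c x y)
    have "pure a b * x \<in> pm.span bilinear_relators" "x * pure a b \<in> pm.span bilinear_relators"
      using step(1) by (simp_all add: pm.span_base pure_mult_bilinear_relators)
    with step show ?case
      by (auto simp: distrib_left distrib_right pm_scale_mult_left pm_scale_mult_right
          intro!: pm.span_add pm.span_scale)
  qed
  have "p * r \<in> pm.span bilinear_relators \<and> r * p \<in> pm.span bilinear_relators"
  proof (induction p rule: pm_induct)
    case zero
    then show ?case by (simp add: pm.span_zero)
  next
    case (add k v q)
    obtain a b where k: "k = Pr a b" by (cases k)
    show ?case
      using add pure[of a b]
      by (auto simp: k single_eq_pm_scale_pure distrib_left distrib_right pm_scale_mult_left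
          pm_scale_mult_right intro!: pm.span_add pm.span_scale)
  qed
  then show "p * r \<in> pm.span bilinear_relators" "r * p \<in> pm.span bilinear_relators" by auto
qed

lemma two_sided_ideal_bilinear: "two_sided_ideal (pm.span bilinear_relators)"
  by unfold_locales (auto intro: pm.span_zero pm.span_add mult_span_bilinear_relators)

interpretation tensor_ideal: two_sided_ideal "pm.span bilinear_relators"
  by (rule two_sided_ideal_bilinear)

quotient_type (overloaded) ('a, 'b) tensor =
  "('a::complex_algebra, 'b::complex_algebra) prod_monoid \<Rightarrow>\<^sub>0 complex" /
  "\<lambda>p q. p - q \<in> pm.span bilinear_relators"
  by (rule tensor_ideal.cong_equivp)

instantiation tensor :: (complex_algebra, complex_algebra) complex_algebra
begin

lift_definition zero_tensor :: "('a, 'b) tensor" is 0 .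
lift_definition one_tensor :: "('a, 'b) tensor" is 1 .
lift_definition plus_tensor :: "('a, 'b) tensor \<Rightarrow> ('a, 'b) tensor \<Rightarrow> ('a, 'b) tensor" is "(+)"
  by (rule tensor_ideal.cong_add)
lift_definition minus_tensor :: "('a, 'b) tensor \<Rightarrow> ('a, 'b) tensor \<Rightarrow> ('a, 'b) tensor" is "(-)"
  by (rule tensor_ideal.cong_diff)
lift_definition uminus_tensor :: "('a, 'b) tensor \<Rightarrow> ('a, 'b) tensor" is uminus
  by (rule tensor_ideal.cong_uminus)
lift_definition times_tensor :: "('a, 'b) tensor \<Rightarrow> ('a, 'b) tensor \<Rightarrow> ('a, 'b) tensor" is "(*)"
  by (rule tensor_ideal.cong_mult)
lift_definition cscale_tensor :: "complex \<Rightarrow> ('a, 'b) tensor \<Rightarrow> ('a, 'b) tensor" is pm_scale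
  by (rule two_sided_ideal_cong_pm_scale[OF two_sided_ideal_bilinear])

instance
  by standard
    (transfer; simp add: algebra_simps tensor_ideal.zero pm_scale_add_right pm_scale_add_left
      pm_scale_scale pm_scale_one pm_scale_mult_left pm_scale_mult_right)+

end

lift_definition tensor_of :: "'a::complex_algebra \<Rightarrow> 'b::complex_algebra \<Rightarrow> ('a, 'b) tensor"
  (infixr \<open>\<otimes>\<close> 75) is pure .


section \<open>The elements \<open>O\<^sub>i\<^sub>j\<close>\<close>

text \<open>Elements of either factor are read in the tensor product via \<open>w \<mapsto> w \<otimes> 1\<close> and \<open>c \<mapsto> 1 \<otimes> c\<close>.\<close>

definition Oel :: "'n \<Rightarrow> 'n \<Rightarrow> ('n weyl, 'n clifford) tensor" where
  "Oel i j = (weyl_x i * weyl_y j) \<otimes> 1 - (weyl_x j * weyl_y i) \<otimes> 1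
     + (1/2) *\<^sub>C (1 \<otimes> (clifford_e i * clifford_e j))"


section \<open>Diagrams\<close>

definition chords :: "('n::linorder \<times> 'n) set" where
  "chords = {(i, j). i < j}"

text \<open>A diagram is the multiset of its chords, so that \<open>m\<^sub>i\<^sub>j\<close> is \<^term>\<open>count D (i, j)\<close>.\<close>

definition diagram :: "('n::linorder \<times> 'n) multiset \<Rightarrow> bool" where
  "diagram D \<longleftrightarrow> set_mset D \<subseteq> chords"

definition crossed :: "('n::linorder \<times> 'n) multiset \<Rightarrow> bool" where
  "crossed D \<longleftrightarrow>
     (\<exists>i j k l. i < j \<and> j < k \<and> k < l \<and> count D (i, k) \<ge> 1 \<and> count D (j, l) \<ge> 1)"

definition uncrossable :: "('n::linorder \<times> 'n) multiset \<Rightarrow> bool" where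
  "uncrossable D \<longleftrightarrow> diagram D \<and>
     (\<not> crossed D \<or>
      (\<exists>D' i j. diagram D' \<and> \<not> crossed D' \<and> i < j \<and> D = add_mset (i, j) D'))"


section \<open>Ordered monomials\<close>

definition increasing_list :: "'a rel \<Rightarrow> 'a set \<Rightarrow> 'a list" where
  "increasing_list r A = (THE xs. distinct xs \<and> set xs = A \<and> sorted_wrt (\<lambda>a b. (a, b) \<in> r) xs)"

lemma increasing_list_unique:
  assumes "finite A" "linear_order_on A r"
  shows "\<exists>!xs. distinct xs \<and> set xs = A \<and> sorted_wrt (\<lambda>a b. (a, b) \<in> r) xs"
proof -
  have trans: "trans r" and anti: "antisym r" and tot: "total_on A r" and refl: "refl_on A r"
    using assms(2) by (auto simp: linear_order_on_def partial_order_on_def preorder_on_def)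
  have ex: "\<exists>xs. distinct xs \<and> set xs = B \<and> sorted_wrt (\<lambda>a b. (a, b) \<in> r) xs"
    if "finite B" "B \<subseteq> A" for B
    using that
  proof (induction B rule: finite_induct)
    case empty
    then show ?case by simp
  next
    case (insert b B)
    then obtain xs where xs: "distinct xs" "set xs = B" "sorted_wrt (\<lambda>a b. (a, b) \<in> r) xs"
      by auto
    let ?P = "\<lambda>x. (x, b) \<in> r"
    let ?ys = "filter ?P xs @ b # filter (\<lambda>x. \<not> ?P x) xs"
    have rb: "(b, x) \<in> r" if "x \<in> B" "\<not> ?P x" for x
    proof -
      have "x \<noteq> b" "x \<in> A" "b \<in> A" using that insert.prems insert.hyps by auto
      with tot that(2) show ?thesis by (auto simp: total_on_def)
    qed
    have "(x, y) \<in> r" if "?P x" "y \<in> B" "\<not> ?P y" for x y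
      using transD[OF trans that(1) rb[OF that(2,3)]] .
    then have "sorted_wrt (\<lambda>a b. (a, b) \<in> r) ?ys"
      using xs rb by (simp add: sorted_wrt_append sorted_wrt_filter)
    moreover have "distinct ?ys" "set ?ys = insert b B"
      using xs insert.hyps by auto
    ultimately show ?case by blast
  qed
  show ?thesis
  proof (rule ex_ex1I)
    show "\<exists>xs. distinct xs \<and> set xs = A \<and> sorted_wrt (\<lambda>a b. (a, b) \<in> r) xs"
      using ex assms(1) by blast
  next
    fix xs ys
    assume "distinct xs \<and> set xs = A \<and> sorted_wrt (\<lambda>a b. (a, b) \<in> r) xs"
      and "distinct ys \<and> set ys = A \<and> sorted_wrt (\<lambda>a b. (a, b) \<in> r) ys"
    then have "distinct xs" "distinct ys" "set xs = set ys"
      "sorted_wrt (\<lambda>a b. (a, b) \<in> r) xs" "sorted_wrt (\<lambda>a b. (a, b) \<in> r) ys"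
      by auto
    then show "xs = ys"
    proof (induction xs arbitrary: ys)
      case Nil
      then show ?case by simp
    next
      case (Cons x xs)
      then obtain y zs where ys: "ys = y # zs" by (cases ys) auto
      have "x = y"
      proof (rule ccontr)
        assume "x \<noteq> y"
        then have "(x, y) \<in> r" "(y, x) \<in> r"
          using Cons.prems by (auto simp: ys)
        with anti \<open>x \<noteq> y\<close> show False by (auto dest: antisymD)
      qed
      moreover have "xs = zs"
      proof (rule Cons.IH)
        show "set xs = set zs"
          using Cons.prems \<open>x = y\<close> by (auto simp: ys)
      qed (use Cons.prems in \<open>auto simp: ys\<close>)
      ultimately show ?case by (simp add: ys)
    qed
  qed
qed

definition ordered_monomial ::
    "('n \<times> 'n) rel \<Rightarrow> ('n \<times> 'n) multiset \<Rightarrow> ('n::{finite,linorder} weyl, 'n clifford) tensor" where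
  "ordered_monomial r D =
     prod_list (map (\<lambda>(i, j). Oel i j ^ count D (i, j)) (increasing_list r chords))"

end

theory Submission
  imports Defs
begin

text \<open>
  The elements \<open>O\<^sub>i\<^sub>j\<close> satisfy the commutation relations of \<open>so(n)\<close>. Hence reordering a product of
  them changes it by shorter products only, and up to shorter products such a product depends on
  the multiset of its chords alone.

  \<^bold>\<open>Spanning.\<close> Let \<open>E\<^sub>i\<^sub>j\<^sub>k\<^sub>l = O\<^sub>i\<^sub>j O\<^sub>k\<^sub>l - O\<^sub>i\<^sub>k O\<^sub>j\<^sub>l + O\<^sub>i\<^sub>l O\<^sub>j\<^sub>k\<close>. For the purely orbital elements
  \<open>x\<^sub>i y\<^sub>j - x\<^sub>j y\<^sub>i\<close> this expression is a Pluecker relation and vanishes, so that a single crossing could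
  be replaced by uncrossed chords. The Clifford part spoils this, but only to first order: \<open>E\<^sup>2\<close>, of degree
  four at first sight, is \<open>3/16 - 1/4 \<Sum> O\<^sub>p\<^sub>q\<^sup>2\<close>, of degree two (\<open>E_square\<close>). Commuting
  \<open>E\<^sub>i\<^sub>j\<^sub>k\<^sub>p\<close> with \<open>O\<^sub>p\<^sub>q\<close> produces \<open>- E\<^sub>i\<^sub>j\<^sub>k\<^sub>q\<close>, so the relation for squares spreads to products of two
  such elements that share three indices, where it still gives degree at most three. On at most
  five vertices any two index sets of size four share three elements, so every product of two of
  the \<open>E\<close> has degree at most three (\<open>E_product_filtration\<close>). In other words, two crossings can be removed
  together. A diagram on at most five vertices that is not uncrossable does contain two crossings
  made of four of its chords, counted with multiplicity (\<open>not_uncrossable_two_crossings\<close>), and removing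
  them lowers a weight for which crossing pairs are heavy (\<open>weight_uncross\<close>).

  \<^bold>\<open>Independence.\<close> The tensor product acts on functions in such a way that the leading symbol of
  \<open>O\<^sub>i\<^sub>j\<close> is \<open>\<ell>\<^sub>i\<^sub>j + 1/2 \<theta>\<^sub>i \<theta>\<^sub>j\<close> with \<open>\<ell>\<^sub>i\<^sub>j = u\<^sub>i v\<^sub>j - u\<^sub>j v\<^sub>i\<close> and anticommuting \<open>\<theta>\<^sub>i\<close>. If \<open>f\<close>, a
  polynomial in commuting variables \<open>z\<^sub>i\<^sub>j\<close>, is the top degree part of a linear combination that
  vanishes, then the coefficients of \<open>1\<close> and of \<open>\<theta>\<^sub>i \<theta>\<^sub>j\<close> say that \<open>f\<close> and all its partial derivatives
  vanish at \<open>z = \<ell>\<close>. Let \<open>M\<close> be an uncrossable diagram of maximal weight that occurs in \<open>f\<close>. Either \<open>M\<close>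
  is uncrossed, or \<open>M\<close> minus a chord \<open>c\<close> is; in the second case \<open>M - c\<close> occurs in \<open>\<partial>f/\<partial>z\<^sub>c\<close>, again with
  maximal weight. Rewriting crossed products of the \<open>\<ell>\<^sub>i\<^sub>j\<close> by Pluecker relations produces uncrossed
  ones of smaller weight only and cannot cancel this term
  (\<open>top_uncrossed_coefficient_zero\<close>), whereas uncrossed products of the \<open>\<ell>\<^sub>i\<^sub>j\<close> are linearly
  independent (\<open>uncrossed_minors_independent\<close>).
\<close>


section \<open>Homomorphisms out of algebras given by generators and relations\<close>

definition linear_extension :: "('m \<Rightarrow> 'b::complex_algebra) \<Rightarrow> ('m \<Rightarrow>\<^sub>0 complex) \<Rightarrow> 'b" where
  "linear_extension f p = (\<Sum>k\<in>Poly_Mapping.keys p. Poly_Mapping.lookup p k *\<^sub>C f k)"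

lemma linear_extension_superset:
  assumes "finite A" "Poly_Mapping.keys p \<subseteq> A"
  shows "linear_extension f p = (\<Sum>k\<in>A. Poly_Mapping.lookup p k *\<^sub>C f k)"
  unfolding linear_extension_def using assms
  by (intro sum.mono_neutral_left) (auto simp: in_keys_iff)

lemma linear_extension_0 [simp]: "linear_extension f 0 = 0"
  by (simp add: linear_extension_def)

lemma linear_extension_single [simp]: "linear_extension f (Poly_Mapping.single k v) = v *\<^sub>C f k"
  by (subst linear_extension_superset[of "{k}"]) auto

lemma linear_extension_add: "linear_extension f (p + q) = linear_extension f p + linear_extension f q"
proof -
  let ?A = "Poly_Mapping.keys p \<union> Poly_Mapping.keys q"
  have "Poly_Mapping.keys (p + q) \<subseteq> ?A" by (rule Poly_Mapping.keys_add)
  then show ?thesis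
    by (simp add: linear_extension_superset[of ?A] lookup_add cvec.scale_left_distrib sum.distrib)
qed

lemma linear_extension_scale: "linear_extension f (pm_scale c p) = c *\<^sub>C linear_extension f p"
  by (induction p rule: pm_induct)
    (simp_all add: pm_scale_zero_right pm_scale_add_right pm_scale_single linear_extension_add
      cvec.scale_right_distrib)

lemma linear_extension_diff: "linear_extension f (p - q) = linear_extension f p - linear_extension f q"
proof -
  have "linear_extension f (p - q) + linear_extension f q = linear_extension f p"
    by (simp flip: linear_extension_add)
  then show ?thesis by (simp add: algebra_simps)
qed

lemma linear_extension_sum:
  "linear_extension f (\<Sum>i\<in>I. p i) = (\<Sum>i\<in>I. linear_extension f (p i))"
  by (induction I rule: infinite_finite_induct) (simp_all add: linear_extension_add)

lemma linear_extension_mult: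
  fixes f :: "'m::monoid_add \<Rightarrow> 'b::complex_algebra"
  assumes "\<And>k l. f (k + l) = f k * f l"
  shows "linear_extension f (p * q) = linear_extension f p * linear_extension f q"
proof (induction p rule: pm_induct)
  case (add k v p)
  have "linear_extension f (Poly_Mapping.single k v * q) = v *\<^sub>C f k * linear_extension f q"
    by (induction q rule: pm_induct)
      (simp_all add: distrib_left linear_extension_add mult_single assms cscale_mult_left
        cscale_mult_right cscale_cscale mult.commute)
  with add show ?case by (simp add: distrib_right linear_extension_add)
qed simp

locale algebra_hom =
  fixes h :: "'a::complex_algebra \<Rightarrow> 'b::complex_algebra"
  assumes add: "h (a + b) = h a + h b"
    and mult: "h (a * b) = h a * h b"
    and one: "h 1 = 1"
    and scale: "h (c *\<^sub>C a) = c *\<^sub>C h a"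
begin

lemma zero: "h 0 = 0"
  using scale[of 0 0] by simp

lemma minus: "h (a - b) = h a - h b"
  using add[of "a - b" b] by simp

lemma sum: "h (\<Sum>i\<in>I. f i) = (\<Sum>i\<in>I. h (f i))"
  by (induction I rule: infinite_finite_induct) (simp_all add: zero add)

end

fun word_value :: "('g \<Rightarrow> 'b::monoid_mult) \<Rightarrow> 'g free_monoid \<Rightarrow> 'b" where
  "word_value g (Word w) = prod_list (map g w)"

lemma word_value_add: "word_value g (k + l) = word_value g k * word_value g l"
  by (cases k; cases l) simp

abbreviation evaluate :: "('g \<Rightarrow> 'b::complex_algebra) \<Rightarrow> 'g free_algebra \<Rightarrow> 'b" where
  "evaluate g \<equiv> linear_extension (word_value g)"

lemma evaluate_gvar [simp]: "evaluate g (gvar i) = g i"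
  by (simp add: gvar_def)

lemma evaluate_mult: "evaluate g (p * q) = evaluate g p * evaluate g q"
  by (rule linear_extension_mult) (rule word_value_add)

lemma evaluate_1 [simp]: "evaluate g 1 = 1"
  by (simp add: zero_free_monoid_def flip: single_one)

text \<open>
  The kernel of a homomorphism is a two-sided ideal, so it is enough to look at the relators.
\<close>
lemma evaluate_ideal:
  assumes "\<And>r. r \<in> R \<Longrightarrow> evaluate g r = 0" "p \<in> generated_ideal R"
  shows "evaluate g p = 0"
  using assms(2)
  by induction (simp_all add: assms(1) linear_extension_add evaluate_mult)

lemma weyl_cases: fixes a :: "'n weyl" obtains p where "a = abs_weyl p"
  using Quotient3_abs_rep[OF Quotient3_weyl, of a] by metis

lemma clifford_cases: fixes a :: "'n clifford" obtains p where "a = abs_clifford p"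
  using Quotient3_abs_rep[OF Quotient3_clifford, of a] by metis

lemma tensor_cases: fixes a :: "('a::complex_algebra, 'b::complex_algebra) tensor" obtains p where "a = abs_tensor p"
  using Quotient3_abs_rep[OF Quotient3_tensor, of a] by metis

lemma weyl_universal:
  fixes x y :: "'n \<Rightarrow> 'b::complex_algebra"
  assumes "\<And>i j. y i * x j - x j * y i = (if i = j then 1 else 0)"
    and "\<And>i j. x i * x j = x j * x i" and "\<And>i j. y i * y j = y j * y i"
  obtains h where "algebra_hom h" "\<And>i. h (weyl_x i) = x i" "\<And>i. h (weyl_y i) = y i"
proof -
  define g where "g = case_weyl_gen x y"
  have "evaluate g r = 0" if "r \<in> weyl_relators" for r
    using that
    by (auto simp: weyl_relators_def linear_extension_diff evaluate_mult g_def assms)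
  then have ideal: "evaluate g p = evaluate g q" if "p - q \<in> generated_ideal weyl_relators" for p q
    using evaluate_ideal[OF _ that, of g] by (simp add: linear_extension_diff)
  define h where "h a = evaluate g (rep_weyl a)" for a
  have h: "h (abs_weyl p) = evaluate g p" for p
    unfolding h_def
    by (rule ideal) (rule Quotient3_rep_abs[OF Quotient3_weyl]; simp add: weyl_ideal.zero)
  show thesis
  proof
    show "algebra_hom h"
    proof
      fix a b :: "'n weyl" and c
      obtain p q where "a = abs_weyl p" "b = abs_weyl q"
        by (metis weyl_cases)
      then show "h (a + b) = h a + h b" "h (a * b) = h a * h b" "h (c *\<^sub>C a) = c *\<^sub>C h a"
        by (simp_all add: h plus_weyl.abs_eq times_weyl.abs_eq cscale_weyl.abs_eq
            linear_extension_add evaluate_mult linear_extension_scale)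
    qed (simp add: one_weyl_def h)
  qed (simp_all add: weyl_x_def weyl_y_def h g_def)
qed

lemma clifford_universal:
  fixes e :: "'n \<Rightarrow> 'b::complex_algebra"
  assumes "\<And>i j. e i * e j + e j * e i = (if i = j then 1 + 1 else 0)"
  obtains h where "algebra_hom h" "\<And>i. h (clifford_e i) = e i"
proof -
  have "evaluate e r = 0" if "r \<in> clifford_relators" for r
    using that
    by (auto simp: clifford_relators_def linear_extension_diff linear_extension_add evaluate_mult
        assms simp flip: one_add_one)
  then have ideal: "evaluate e p = evaluate e q" if "p - q \<in> generated_ideal clifford_relators" for p q
    using evaluate_ideal[OF _ that, of e] by (simp add: linear_extension_diff)
  define h where "h a = evaluate e (rep_clifford a)" for a
  have h: "h (abs_clifford p) = evaluate e p" for p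
    unfolding h_def
    by (rule ideal) (rule Quotient3_rep_abs[OF Quotient3_clifford]; simp add: clifford_ideal.zero)
  show thesis
  proof
    show "algebra_hom h"
    proof
      fix a b :: "'n clifford" and c
      obtain p q where "a = abs_clifford p" "b = abs_clifford q"
        by (metis clifford_cases)
      then show "h (a + b) = h a + h b" "h (a * b) = h a * h b" "h (c *\<^sub>C a) = c *\<^sub>C h a"
        by (simp_all add: h plus_clifford.abs_eq times_clifford.abs_eq cscale_clifford.abs_eq
            linear_extension_add evaluate_mult linear_extension_scale)
    qed (simp add: one_clifford_def h)
  qed (simp_all add: clifford_e_def h)
qed

text \<open>
  The images of the two factors must commute, because \<open>a \<otimes> 1\<close> and \<open>1 \<otimes> b\<close> do.
\<close>
lemma tensor_universal:
  fixes f :: "'a::complex_algebra \<Rightarrow> 'c::complex_algebra" and g :: "'b::complex_algebra \<Rightarrow> 'c"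
  assumes f: "algebra_hom f" and g: "algebra_hom g" and comm: "\<And>a b. f a * g b = g b * f a"
  obtains h where "algebra_hom h" "\<And>a b. h (a \<otimes> b) = f a * g b"
proof -
  interpret f: algebra_hom f by (rule f)
  interpret g: algebra_hom g by (rule g)
  define \<phi> where "\<phi> k = (case k of Pr a b \<Rightarrow> f a * g b)" for k
  have \<phi>_Pr [simp]: "\<phi> (Pr a b) = f a * g b" for a b
    by (simp add: \<phi>_def)
  have "\<phi> (k + l) = \<phi> k * \<phi> l" for k l
    by (cases k; cases l) (simp add: f.mult g.mult mult.assoc, metis comm mult.assoc)
  note mult = linear_extension_mult[OF this]
  have pure [simp]: "linear_extension \<phi> (pure a b) = f a * g b" for a b
    by (simp add: pure_def)
  have rel: "linear_extension \<phi> r = 0" if "r \<in> bilinear_relators" for r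
    using that
    by (auto simp: bilinear_relators_def linear_extension_diff linear_extension_scale
        f.add g.add f.scale g.scale distrib_left distrib_right cscale_mult_left cscale_mult_right)
  have "linear_extension \<phi> r = 0" if "r \<in> pm.span bilinear_relators" for r
    using that
    by (induction rule: pm.span_induct_alt)
      (simp_all add: linear_extension_add linear_extension_scale rel)
  then have ideal: "linear_extension \<phi> p = linear_extension \<phi> q"
    if "p - q \<in> pm.span bilinear_relators" for p q
    using that by (metis linear_extension_diff right_minus_eq)
  define h where "h a = linear_extension \<phi> (rep_tensor a)" for a
  have h: "h (abs_tensor p) = linear_extension \<phi> p" for p
    unfolding h_def
    by (rule ideal) (rule Quotient3_rep_abs[OF Quotient3_tensor]; simp add: tensor_ideal.zero)
  show thesis
  proof
    show "algebra_hom h"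
    proof
      fix a b :: "('a, 'b) tensor" and c
      obtain p q where "a = abs_tensor p" "b = abs_tensor q"
        by (metis tensor_cases)
      then show "h (a + b) = h a + h b" "h (a * b) = h a * h b" "h (c *\<^sub>C a) = c *\<^sub>C h a"
        by (simp_all add: h plus_tensor.abs_eq times_tensor.abs_eq cscale_tensor.abs_eq
            linear_extension_add mult linear_extension_scale)
    next
      have "linear_extension \<phi> 1 = 1"
        by (simp add: zero_prod_monoid_def f.one g.one flip: single_one)
      then show "h 1 = 1" by (simp add: one_tensor_def h)
    qed
  qed (simp add: tensor_of_def h)
qed

text \<open>
  That the generators of the Weyl and Clifford algebras really generate them is not part of the universal
  properties above. It lets two homomorphisms with commuting values on generators have commuting images.
\<close>
lemma free_algebra_induct:
  assumes "P 0" "P 1" and "\<And>p q. P p \<Longrightarrow> P q \<Longrightarrow> P (p + q)"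
    and "\<And>g p. P p \<Longrightarrow> P (gvar g * p)" and "\<And>c p. P p \<Longrightarrow> P (pm_scale c p)"
  shows "P p"
proof (induction p rule: pm_induct)
  case (add k v q)
  obtain w where k: "k = Word w" by (cases k)
  have "P (Poly_Mapping.single (Word w) 1)"
  proof (induction w)
    case Nil
    then show ?case using assms(2) by (simp add: zero_free_monoid_def flip: single_one)
  next
    case (Cons i w)
    then have "P (gvar i * Poly_Mapping.single (Word w) 1)" by (rule assms(4))
    then show ?case by (simp add: gvar_def mult_single)
  qed
  then have "P (pm_scale v (Poly_Mapping.single (Word w) 1))" by (rule assms(5))
  with add show ?case by (simp add: k pm_scale_single assms(3))
qed (rule assms(1))

lemma weyl_generated: "a \<in> generated_subalgebra (range weyl_x \<union> range weyl_y)"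
proof -
  note intros = generated_subalgebra.intros
  have zero: "0 \<in> generated_subalgebra S" for S :: "'n weyl set"
    using intros(5)[OF intros(2), of 0] by simp
  obtain p where "a = abs_weyl p" by (metis weyl_cases)
  moreover have "abs_weyl p \<in> generated_subalgebra (range weyl_x \<union> range weyl_y)"
  proof (induction p rule: free_algebra_induct)
    case (4 g p)
    have "abs_weyl (gvar g) \<in> range weyl_x \<union> range weyl_y"
      by (cases g) (auto simp: weyl_x_def weyl_y_def)
    with 4 show ?case by (auto simp flip: times_weyl.abs_eq intro: intros)
  qed (auto simp flip: zero_weyl_def one_weyl_def plus_weyl.abs_eq cscale_weyl.abs_eq
      intro: intros zero)
  ultimately show ?thesis by simp
qed

lemma clifford_generated: "a \<in> generated_subalgebra (range clifford_e)"
proof -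
  note intros = generated_subalgebra.intros
  have zero: "0 \<in> generated_subalgebra S" for S :: "'n clifford set"
    using intros(5)[OF intros(2), of 0] by simp
  obtain p where "a = abs_clifford p" by (metis clifford_cases)
  moreover have "abs_clifford p \<in> generated_subalgebra (range clifford_e)"
    by (induction p rule: free_algebra_induct)
      (auto simp flip: zero_clifford_def one_clifford_def plus_clifford.abs_eq times_clifford.abs_eq
        cscale_clifford.abs_eq clifford_e.abs_eq intro: intros zero)
  ultimately show ?thesis by simp
qed

lemma commute_generated_subalgebra:
  assumes "\<And>s. s \<in> S \<Longrightarrow> s * b = b * s" "a \<in> generated_subalgebra S"
  shows "a * b = b * a"
  using assms(2)
proof induction
  case (mult a a')
  then show ?case by (metis mult.assoc)
qed (simp_all add: assms(1) distrib_left distrib_right cscale_mult_left cscale_mult_right)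

lemma (in algebra_hom) image_generated:
  assumes "a \<in> generated_subalgebra S"
  shows "h a \<in> generated_subalgebra (h ` S)"
  using assms by induction (auto simp: add mult one scale intro: generated_subalgebra.intros)


section \<open>A representation on functions\<close>

text \<open>
  All linear maps on the space of functions on a set. Making them a \<^class>\<open>complex_algebra\<close> lets a
  representation be obtained from the universal properties.
\<close>
typedef 'i operator = "{f :: ('i \<Rightarrow> complex) \<Rightarrow> 'i \<Rightarrow> complex.
    (\<forall>v w. f (\<lambda>s. v s + w s) = (\<lambda>s. f v s + f w s)) \<and> (\<forall>c v. f (\<lambda>s. c * v s) = (\<lambda>s. c * f v s))}"
  morphisms apply_op Operator
  by (rule exI[of _ id]) simp

setup_lifting type_definition_operator

instantiation operator :: (type) complex_algebra
begin

lift_definition zero_operator :: "'a operator" is "\<lambda>v s. 0" by simp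
lift_definition one_operator :: "'a operator" is "\<lambda>v. v" by simp
lift_definition plus_operator :: "'a operator \<Rightarrow> 'a operator \<Rightarrow> 'a operator" is
  "\<lambda>f g v s. f v s + g v s" by (simp add: algebra_simps)
lift_definition minus_operator :: "'a operator \<Rightarrow> 'a operator \<Rightarrow> 'a operator" is
  "\<lambda>f g v s. f v s - g v s" by (simp add: algebra_simps)
lift_definition uminus_operator :: "'a operator \<Rightarrow> 'a operator" is
  "\<lambda>f v s. - f v s" by (simp add: algebra_simps)
lift_definition times_operator :: "'a operator \<Rightarrow> 'a operator \<Rightarrow> 'a operator" is
  "\<lambda>f g v. f (g v)" by simp
lift_definition cscale_operator :: "complex \<Rightarrow> 'a operator \<Rightarrow> 'a operator" is
  "\<lambda>c f v s. c * f v s" by (simp add: algebra_simps)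

instance
  by standard (transfer; simp add: algebra_simps)+

end

lemma operator_eqI: "(\<And>v s. apply_op f v s = apply_op g v s) \<Longrightarrow> f = g"
  by transfer blast

text \<open>
  The sign of moving the \<open>i\<close>-th generator of an exterior algebra past the generators in \<open>S\<close> that
  precede it.
\<close>
definition exchange_sign :: "'n::linorder \<Rightarrow> 'n set \<Rightarrow> complex" where
  "exchange_sign i S = (- 1) ^ card {k\<in>S. k < i}"

definition flip :: "'n \<Rightarrow> 'n set \<Rightarrow> 'n set" where
  "flip i S = (if i \<in> S then S - {i} else insert i S)"

text \<open>
  Functions of \<open>(s, S)\<close> stand for \<open>\<Sum> v(s, S) \<theta>\<^sub>S\<close>. The Weyl algebra acts by weighted shifts of \<open>s\<close>: with
  \<open>y\<^sub>i\<close> a forward shift and \<open>x\<^sub>i\<close> a backward shift times \<open>s\<^sub>i\<close>, the commutator is \<open>(s\<^sub>i + 1) - s\<^sub>i = 1\<close>. The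
  scaling by \<open>a\<close> (conjugation with \<open>\<Prod> a\<^sub>i powr s\<^sub>i\<close>) makes the symbols of \<open>x\<^sub>i\<close> and \<open>y\<^sub>i\<close> independent quantities
  \<open>s\<^sub>i / a\<^sub>i\<close> and \<open>a\<^sub>i\<close>. The Clifford generator \<open>e\<^sub>i\<close> acts as multiplication by \<open>\<theta>\<^sub>i\<close> plus the derivative with respect
  to \<open>\<theta>\<^sub>i\<close>.
\<close>
lift_definition op_x :: "('n \<Rightarrow> complex) \<Rightarrow> 'n \<Rightarrow> (('n \<Rightarrow> complex) \<times> 'n set) operator" is
  "\<lambda>a i v (s, S). s i / a i * v (s(i := s i - 1), S)"
  by (auto simp: algebra_simps fun_eq_iff)

lift_definition op_y :: "('n \<Rightarrow> complex) \<Rightarrow> 'n \<Rightarrow> (('n \<Rightarrow> complex) \<times> 'n set) operator" is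
  "\<lambda>a i v (s, S). a i * v (s(i := s i + 1), S)"
  by (auto simp: algebra_simps fun_eq_iff)

lift_definition op_e :: "'n::linorder \<Rightarrow> (('n \<Rightarrow> complex) \<times> 'n set) operator" is
  "\<lambda>i v (s, S). exchange_sign i S * v (s, flip i S)"
  by (auto simp: algebra_simps fun_eq_iff)

lemma flip_flip [simp]: "flip i (flip i S) = S"
  by (auto simp: flip_def)

lemma flip_commute: "flip i (flip j S) = flip j (flip i S)"
  by (auto simp: flip_def)

lemma exchange_sign_square [simp]: "exchange_sign i S * exchange_sign i S = 1"
  by (simp add: exchange_sign_def flip: power_add)

lemma exchange_sign_cancel: "exchange_sign i S * (exchange_sign i S * z) = z"
  by (simp flip: mult.assoc)

lemma exchange_sign_flip:
  fixes i j :: "'n::{finite,linorder}"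
  shows "exchange_sign i (flip j S) = (if j < i then - exchange_sign i S else exchange_sign i S)"
proof (cases "j < i")
  case True
  have "{k \<in> flip j S. k < i} = (if j \<in> S then {k \<in> S. k < i} - {j} else insert j {k \<in> S. k < i})"
    using True by (auto simp: flip_def)
  moreover have "(- 1 :: complex) ^ card {k \<in> S. k < i} = - ((- 1) ^ card ({k \<in> S. k < i} - {j}))"
    if "j \<in> S"
  proof -
    have "card {k \<in> S. k < i} = Suc (card ({k \<in> S. k < i} - {j}))"
      using that True by (intro card_Suc_Diff1[symmetric]) auto
    then show ?thesis by simp
  qed
  ultimately show ?thesis
    using True by (simp add: exchange_sign_def)
next
  case False
  then have "{k \<in> flip j S. k < i} = {k \<in> S. k < i}"
    by (auto simp: flip_def)
  with False show ?thesis by (simp add: exchange_sign_def)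
qed

text \<open>
  Operators that shift \<open>s\<close> commute with operators that change \<open>S\<close>, so the two actions combine.
\<close>
lemma tensor_representation:
  fixes a :: "'n::{finite,linorder} \<Rightarrow> complex"
  assumes a: "\<And>i. a i \<noteq> 0"
  obtains h :: "('n weyl, 'n clifford) tensor \<Rightarrow> (('n \<Rightarrow> complex) \<times> 'n set) operator"
  where "algebra_hom h"
    and "\<And>i j. h (Oel i j) =
      op_x a i * op_y a j - op_x a j * op_y a i + (1/2) *\<^sub>C (op_e i * op_e j)"
proof -
  note ops = op_x.rep_eq op_y.rep_eq op_e.rep_eq plus_operator.rep_eq minus_operator.rep_eq
    times_operator.rep_eq one_operator.rep_eq zero_operator.rep_eq
  obtain f where f: "algebra_hom f" "\<And>i. f (weyl_x i) = op_x a i" "\<And>i. f (weyl_y i) = op_y a i"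
  proof (rule weyl_universal[of "op_y a" "op_x a"])
    show "op_y a i * op_x a j - op_x a j * op_y a i = (if i = j then 1 else 0)" for i j
      by (rule operator_eqI)
        (auto simp: ops a fun_upd_twist field_simps split: prod.splits)
    show "op_x a i * op_x a j = op_x a j * op_x a i" for i j
      by (rule operator_eqI) (cases "i = j"; auto simp: ops fun_upd_twist mult.commute mult.left_commute split: prod.splits)
    show "op_y a i * op_y a j = op_y a j * op_y a i" for i j
      by (rule operator_eqI) (cases "i = j"; auto simp: ops fun_upd_twist mult.commute mult.left_commute split: prod.splits)
  qed blast
  obtain g where g: "algebra_hom g" "\<And>i::'n. g (clifford_e i) = op_e i"
  proof (rule clifford_universal[of "op_e :: 'n \<Rightarrow> _"])
    show "op_e i * op_e j + op_e j * op_e i = (if i = j then 1 + 1 else 0)" for i j :: 'n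
      by (rule operator_eqI)
        (cases i j rule: linorder_cases;
         auto simp: ops exchange_sign_flip flip_commute mult.commute mult.left_commute
           exchange_sign_cancel split: prod.splits)
  qed blast
  interpret f: algebra_hom f by (rule f)
  interpret g: algebra_hom g by (rule g)
  have x: "op_x a i * op_e j = op_e j * op_x a i" and y: "op_y a i * op_e j = op_e j * op_y a i" for i j
    by (rule operator_eqI; auto simp: ops split: prod.splits)+
  have fe: "f p * op_e j = op_e j * f p" for p j
    by (rule commute_generated_subalgebra[OF _ f.image_generated[OF weyl_generated]])
      (auto simp: f x y)
  have "g q * f p = f p * g q" for p q
    by (rule commute_generated_subalgebra[OF _ g.image_generated[OF clifford_generated]])
      (auto simp: g fe)
  then have "f p * g q = g q * f p" for p q by simp
  then obtain h where h: "algebra_hom h" "\<And>p q. h (p \<otimes> q) = f p * g q"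
    using tensor_universal[OF f(1) g(1)] by metis
  interpret h: algebra_hom h by (rule h)
  show thesis
    by (rule that[OF h(1)])
      (simp add: Oel_def h.add h.minus h.scale h(2) f.mult g.mult f.one g.one f(2,3) g(2))
qed


section \<open>Crossings and the uncrossing weight\<close>

definition crossing :: "'n::linorder \<times> 'n \<Rightarrow> 'n \<times> 'n \<Rightarrow> bool" where
  "crossing c d \<longleftrightarrow> (\<exists>i j k l. i < j \<and> j < k \<and> k < l \<and> (c = (i, k) \<and> d = (j, l) \<or> c = (j, l) \<and> d = (i, k)))"

lemma crossing_neq: "crossing c d \<Longrightarrow> c \<noteq> d"
  by (auto simp: crossing_def)

lemma crossing_distinct:
  "crossing c d \<Longrightarrow> distinct [fst c, snd c, fst d, snd d]"
  by (auto simp: crossing_def)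

lemma add_two_subseteq_mset: "c \<noteq> d \<Longrightarrow> {#c, d#} \<subseteq># D \<longleftrightarrow> c \<in># D \<and> d \<in># D"
  by (simp add: insert_subset_eq_iff in_diff_count)

lemma crossed_iff: "crossed D \<longleftrightarrow> (\<exists>c d. crossing c d \<and> c \<in># D \<and> d \<in># D)"
  unfolding crossed_def crossing_def by (auto simp: Suc_le_eq) blast+

lemma crossing_commute: "crossing c d \<longleftrightarrow> crossing d c"
  by (auto simp: crossing_def)

text \<open>
  Three chords that cross pairwise have six different end points.
\<close>
lemma no_crossing_triple:
  fixes c d f :: "'n::{finite,linorder} \<times> 'n"
  assumes "card (UNIV :: 'n set) \<le> 5" "crossing c d" "crossing d f" "crossing c f"
  shows False
proof -
  have "distinct [fst c, snd c, fst d, snd d, fst f, snd f]"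
    using assms(2-4)[THEN crossing_distinct] by auto
  then have "card (set [fst c, snd c, fst d, snd d, fst f, snd f]) = 6"
    by (subst distinct_card) simp_all
  moreover have "card (set [fst c, snd c, fst d, snd d, fst f, snd f]) \<le> card (UNIV :: 'n set)"
    by (rule card_mono) auto
  ultimately show False using assms(1) by simp
qed

text \<open>
  Let \<open>c\<close> and \<open>d\<close> cross. Since \<open>D\<close> is not uncrossable, deleting \<open>c\<close> or \<open>d\<close> alone leaves a crossing. If the
  rest \<open>R\<close> without both has no crossing, then \<open>R\<close> contains some \<open>f\<close> crossing \<open>d\<close> and some \<open>g\<close>
  crossing \<open>c\<close>. These differ, as otherwise \<open>c\<close>, \<open>d\<close>, \<open>f\<close> would cross pairwise, and \<open>(c, g)\<close>, \<open>(d, f)\<close>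
  are the two crossings.
\<close>
lemma not_uncrossable_two_crossings:
  fixes D :: "('n::{finite,linorder} \<times> 'n) multiset"
  assumes n: "card (UNIV :: 'n set) \<le> 5" and D: "diagram D" "\<not> uncrossable D"
  obtains c d c' d' where "crossing c d" "crossing c' d'" "{#c, d, c', d'#} \<subseteq># D"
proof -
  have crossed_diff: "crossed (D - {#c#})" if "c \<in># D" for c
  proof (rule ccontr)
    assume "\<not> crossed (D - {#c#})"
    moreover have "D = add_mset (fst c, snd c) (D - {#c#})" using that by simp
    moreover have "diagram (D - {#c#})" using D(1) in_diffD by (fastforce simp: diagram_def)
    moreover have "fst c < snd c" using that D(1) by (auto simp: diagram_def chords_def)
    ultimately have "uncrossable D" using D(1) unfolding uncrossable_def by blast
    with D(2) show False by simp
  qed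
  obtain c d where cd: "crossing c d" "c \<in># D" "d \<in># D"
    using D by (auto simp: uncrossable_def crossed_iff)
  have neq: "c \<noteq> d" using cd(1) by (rule crossing_neq)
  obtain R where D_eq: "D = add_mset c (add_mset d R)"
    using cd add_two_subseteq_mset[OF neq, of D] by (auto simp: mset_subset_eq_exists_conv)
  have other: "\<exists>f\<in>#R. crossing d f" if "\<not> crossed R" "D = add_mset c (add_mset d R)" for c d
  proof -
    have "crossed (add_mset d R)" using crossed_diff[of c] that(2) by simp
    then show ?thesis using that(1) crossing_neq crossing_commute by (fastforce simp: crossed_iff)
  qed
  show thesis
  proof (cases "crossed R")
    case True
    then obtain c' d' where "crossing c' d'" "c' \<in># R" "d' \<in># R" by (auto simp: crossed_iff)
    moreover from this have "{#c', d'#} \<subseteq># R"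
      by (simp add: add_two_subseteq_mset crossing_neq)
    ultimately show thesis using that[OF cd(1), of c' d'] by (simp add: D_eq)
  next
    case False
    obtain f g where fg: "f \<in># R" "crossing d f" "g \<in># R" "crossing c g"
      using other[OF False D_eq] other[OF False, of d c] D_eq by (auto simp: add_mset_commute)
    have "f \<noteq> g" using no_crossing_triple[OF n cd(1)] fg by blast
    then have "{#f, g#} \<subseteq># R"
      using fg by (simp add: add_two_subseteq_mset)
    then show thesis using that[OF fg(4) fg(2)] by (simp add: D_eq add_mset_commute)
  qed
qed

definition position :: "'n::linorder \<Rightarrow> nat" where
  "position i = card {k. k < i}"

lemma position_strict_mono: "i < j \<Longrightarrow> position i < position (j :: 'n::{finite,linorder})"
  unfolding position_def by (rule psubset_card_mono) auto

lemma position_less_card: "position (i :: 'n::{finite,linorder}) < card (UNIV :: 'n set)"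
  unfolding position_def by (rule psubset_card_mono) auto

text \<open>
  A strictly concave function of the length of a chord that is invariant under rotation of the
  polygon. Concavity is what makes the two diagonals of a quadrilateral heavier together than either
  pair of opposite sides.
\<close>
definition chord_weight :: "'n::{finite,linorder} \<times> 'n \<Rightarrow> nat" where
  "chord_weight c = (position (snd c) - position (fst c)) *
     (card (UNIV :: 'n set) - (position (snd c) - position (fst c)))"

abbreviation weight :: "('n::{finite,linorder} \<times> 'n) multiset \<Rightarrow> nat" where
  "weight D \<equiv> \<Sum>c\<in>#D. chord_weight c"

lemma weight_uncross:
  fixes i j k l :: "'n::{finite,linorder}"
  assumes "i < j" "j < k" "k < l"
  shows "chord_weight (i, j) + chord_weight (k, l) < chord_weight (i, k) + chord_weight (j, l)"
    and "chord_weight (i, l) + chord_weight (j, k) < chord_weight (i, k) + chord_weight (j, l)"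
proof -
  define n where "n = card (UNIV :: 'n set)"
  obtain a b c d where gaps: "position j = position i + Suc a" "position k = position j + Suc b"
    "position l = position k + Suc c" and d: "n = position l + Suc d"
    using assms[THEN position_strict_mono] position_less_card[of l] unfolding n_def
    by (metis less_natE add_Suc_right)
  \<comment> \<open>The four arcs into which \<open>i, j, k, l\<close> cut the polygon have lengths \<open>a + 1, b + 1, c + 1, e\<close>.\<close>
  define e where "e = position i + Suc d"
  have e: "n = Suc a + Suc b + Suc c + e" "e > 0"
    using gaps d by (simp_all add: e_def)
  have "chord_weight (i, j) = Suc a * (Suc b + Suc c + e)"
    "chord_weight (k, l) = Suc c * (Suc a + Suc b + e)"
    "chord_weight (i, k) = (Suc a + Suc b) * (Suc c + e)"
    "chord_weight (j, l) = (Suc b + Suc c) * (Suc a + e)"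
    "chord_weight (i, l) = (Suc a + Suc b + Suc c) * e"
    "chord_weight (j, k) = Suc b * (Suc a + Suc c + e)"
    unfolding chord_weight_def fst_conv snd_conv n_def[symmetric] e gaps
    by (rule arg_cong2[where f = "(*)"]; simp)+
  then show "chord_weight (i, j) + chord_weight (k, l) < chord_weight (i, k) + chord_weight (j, l)"
    and "chord_weight (i, l) + chord_weight (j, k) < chord_weight (i, k) + chord_weight (j, l)"
    using e(2) by (simp_all add: algebra_simps)
qed


section \<open>Straightening of products of minors\<close>

text \<open>
  Lets \<^const>\<open>linear_extension\<close> evaluate polynomials, seen as combinations of multisets of variables.
\<close>
instantiation complex :: complex_algebra
begin
definition cscale_complex :: "complex \<Rightarrow> complex \<Rightarrow> complex" where "cscale_complex = (*)"
instance by standard (simp_all add: cscale_complex_def algebra_simps)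
end

abbreviation monomial :: "('c \<Rightarrow> complex) \<Rightarrow> 'c multiset \<Rightarrow> complex" where
  "monomial z D \<equiv> \<Prod>c\<in>#D. z c"

definition plucker :: "('n::linorder \<times> 'n \<Rightarrow> complex) \<Rightarrow> bool" where
  "plucker z \<longleftrightarrow> (\<forall>i j k l. i < j \<longrightarrow> j < k \<longrightarrow> k < l \<longrightarrow>
     z (i, k) * z (j, l) = z (i, j) * z (k, l) + z (i, l) * z (j, k))"

lemma crossed_obtain:
  assumes "crossed D"
  obtains i j k l R where "i < j" "j < k" "k < l" "D = {#(i, k), (j, l)#} + R"
proof -
  obtain i j k l where o: "i < j" "j < k" "k < l" "(i, k) \<in># D" "(j, l) \<in># D"
    using assms by (auto simp: crossed_def Suc_le_eq)
  then have "{#(i, k), (j, l)#} \<subseteq># D" by (subst add_two_subseteq_mset) auto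
  then show thesis using that[OF o(1-3)] by (auto simp: mset_subset_eq_exists_conv)
qed

text \<open>
  Each Pluecker step replaces a crossing pair by two pairs of smaller weight, so the process
  terminates. The polynomial \<open>b\<close> does not depend on \<open>z\<close>, hence one rewriting serves all minors at once.
\<close>
lemma straightening:
  fixes D :: "('n::{finite,linorder} \<times> 'n) multiset"
  assumes "diagram D" "crossed D"
  shows "\<exists>b. (\<forall>M\<in>Poly_Mapping.keys b. diagram M \<and> \<not> crossed M \<and> weight M < weight D) \<and>
    (\<forall>z. plucker z \<longrightarrow> linear_extension (monomial z) b = monomial z D)"
  using assms
proof (induction "weight D" arbitrary: D rule: less_induct)
  case less
  obtain i j k l R where o: "i < j" "j < k" "k < l" and D: "D = {#(i, k), (j, l)#} + R"
    using crossed_obtain[OF less.prems(2)] by metis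
  have reduce: "\<exists>b. (\<forall>M\<in>Poly_Mapping.keys b. diagram M \<and> \<not> crossed M \<and> weight M < weight D) \<and>
      (\<forall>z. plucker z \<longrightarrow> linear_extension (monomial z) b = monomial z D')"
    if "diagram D'" "weight D' < weight D" for D' :: "('n \<times> 'n) multiset"
  proof (cases "crossed D'")
    case True
    then show ?thesis using less.hyps[OF that(2) that(1) True] that(2) by (meson less_trans)
  next
    case False
    then show ?thesis
      using that by (intro exI[of _ "Poly_Mapping.single D' 1"]) (simp add: cscale_complex_def)
  qed
  define D1 D2 where "D1 = {#(i, j), (k, l)#} + R" and "D2 = {#(i, l), (j, k)#} + R"
  have dia: "diagram D1" "diagram D2"
    using less.prems(1) o by (auto simp: D D1_def D2_def diagram_def chords_def)
  have wt: "weight D1 < weight D" "weight D2 < weight D"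
    using weight_uncross[OF o] by (simp_all add: D D1_def D2_def)
  obtain b1 b2 where
    b1: "\<forall>M\<in>Poly_Mapping.keys b1. diagram M \<and> \<not> crossed M \<and> weight M < weight D"
      "\<And>z. plucker z \<Longrightarrow> linear_extension (monomial z) b1 = monomial z D1" and
    b2: "\<forall>M\<in>Poly_Mapping.keys b2. diagram M \<and> \<not> crossed M \<and> weight M < weight D"
      "\<And>z. plucker z \<Longrightarrow> linear_extension (monomial z) b2 = monomial z D2"
    using reduce[OF dia(1) wt(1)] reduce[OF dia(2) wt(2)] by metis
  show ?case
  proof (intro exI conjI ballI allI impI)
    fix M assume "M \<in> Poly_Mapping.keys (b1 + b2)"
    then have "M \<in> Poly_Mapping.keys b1 \<union> Poly_Mapping.keys b2"
      using Poly_Mapping.keys_add[of b1 b2] by (rule rev_subsetD)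
    then show "diagram M" "\<not> crossed M" "weight M < weight D" using b1(1) b2(1) by auto
  next
    fix z :: "'n \<times> 'n \<Rightarrow> complex" assume z: "plucker z"
    then have p: "z (i, k) * z (j, l) = z (i, j) * z (k, l) + z (i, l) * z (j, k)"
      using o by (auto simp: plucker_def)
    have "monomial z D = (z (i, k) * z (j, l)) * monomial z R" by (simp add: D)
    also have "\<dots> = monomial z D1 + monomial z D2"
      unfolding p D1_def D2_def by (simp add: algebra_simps)
    finally show "linear_extension (monomial z) (b1 + b2) = monomial z D"
      by (simp add: linear_extension_add b1(2) b2(2) z)
  qed
qed

lemma crossed_mono: "crossed D \<Longrightarrow> D \<subseteq># D' \<Longrightarrow> crossed D'"
  using mset_subset_eqD by (fastforce simp: crossed_iff)

text \<open>
  Reading chords as brackets, the first closing bracket is matched with the last bracket opened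
  before it: a different partner on either side would produce a crossing.
\<close>
lemma first_closing_chord:
  fixes D :: "('n::{finite,linorder} \<times> 'n) multiset"
  assumes "diagram D" "\<not> crossed D" "D \<noteq> {#}"
  defines "j \<equiv> Min (set_mset (image_mset snd D))"
  defines "i \<equiv> Max {i \<in> set_mset (image_mset fst D). i < j}"
  shows "(i, j) \<in># D"
proof -
  have less: "fst c < snd c" if "c \<in># D" for c
    using that assms(1) by (auto simp: diagram_def chords_def)
  have "j \<in> set_mset (image_mset snd D)"
    unfolding j_def using assms(3) by (intro Min_in) auto
  then obtain p where p: "(p, j) \<in># D" by auto
  have "i \<in> {i \<in> set_mset (image_mset fst D). i < j}"
    unfolding i_def using p less[OF p] by (intro Max_in) force+
  then obtain q where q: "(i, q) \<in># D" and "i < j" by auto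
  have "p \<le> i"
    unfolding i_def using p less[OF p] by (intro Max_ge) force+
  moreover have "j \<le> q"
    unfolding j_def using q by (intro Min_le) force+
  moreover have False if "p < i" "j < q"
    using assms(2) p q that \<open>i < j\<close> by (force simp: crossed_iff crossing_def)
  ultimately show ?thesis using p q by (metis order_le_less)
qed

text \<open>
  As for a bracketing, left and right end points determine the matching: by the previous lemma they
  determine one chord, which is then removed.
\<close>
lemma uncrossed_determined_by_ends:
  fixes D D' :: "('n::{finite,linorder} \<times> 'n) multiset"
  assumes "diagram D" "\<not> crossed D" "diagram D'" "\<not> crossed D'"
    and "image_mset fst D = image_mset fst D'" "image_mset snd D = image_mset snd D'"
  shows "D = D'"
  using assms
proof (induction "size D" arbitrary: D D')
  case 0
  then show ?case by auto
next
  case (Suc m)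
  define j where "j = Min (set_mset (image_mset snd D))"
  define i where "i = Max {i \<in> set_mset (image_mset fst D). i < j}"
  have ne: "D \<noteq> {#}" "D' \<noteq> {#}" using Suc.hyps(2) Suc.prems(5) by auto
  have mem: "(i, j) \<in># D" "(i, j) \<in># D'"
    using first_closing_chord[OF Suc.prems(1,2) ne(1)] first_closing_chord[OF Suc.prems(3,4) ne(2)]
    unfolding i_def j_def Suc.prems(5,6) by simp_all
  have sub: "diagram (D - {#(i, j)#})" "diagram (D' - {#(i, j)#})"
    "\<not> crossed (D - {#(i, j)#})" "\<not> crossed (D' - {#(i, j)#})"
    using Suc.prems(1-4) crossed_mono[OF _ diff_subset_eq_self]
    by (auto simp: diagram_def dest!: in_diffD)
  have "D - {#(i, j)#} = D' - {#(i, j)#}"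
  proof (rule Suc.hyps(1)[OF _ sub(1,3,2,4)])
    show "m = size (D - {#(i, j)#})" using Suc.hyps(2) mem by (simp add: size_Diff_singleton)
  qed (use mem Suc.prems(5,6) in \<open>simp_all add: image_mset_Diff\<close>)
  then show ?case using mem by (metis insert_DiffM)
qed

lemma digits_unique:
  fixes d d' :: "nat \<Rightarrow> nat"
  assumes "\<And>k. d k < N" "\<And>k. d' k < N" "(\<Sum>k<m. d k * N ^ k) = (\<Sum>k<m. d' k * N ^ k)" "k < m"
  shows "d k = d' k"
  using assms(3,4)
proof (induction m)
  case (Suc m)
  have bound: "(\<Sum>k<p. f k * N ^ k) < N ^ p" if "\<And>k. f k < N" for f :: "nat \<Rightarrow> nat" and p
  proof (induction p)
    case (Suc p)
    have "(\<Sum>k<Suc p. f k * N ^ k) < (f p + 1) * N ^ p" using Suc by simp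
    also have "\<dots> \<le> N * N ^ p" using that[of p] by (intro mult_right_mono) auto
    finally show ?case by simp
  qed simp
  have div: "(r + q * M) div M = q" if "r < M" for r q M :: nat
  proof -
    have "M \<noteq> 0" using that by simp
    then show ?thesis by (simp add: that)
  qed
  have "d m = (\<Sum>k<Suc m. d k * N ^ k) div N ^ m" "d' m = (\<Sum>k<Suc m. d' k * N ^ k) div N ^ m"
    using bound[of d m] bound[of d' m] by (simp_all add: div assms(1,2))
  then have "d m = d' m" using Suc.prems(1) by simp
  with Suc show ?case by (cases "k = m") auto
qed simp

lemma sum_mset_eq_sum_count:
  fixes P :: "nat multiset"
  assumes "set_mset P \<subseteq> {..<m}"
  shows "(\<Sum>k\<in>#P. f k) = (\<Sum>k<m. count P k * f k :: nat)"
  using assms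
proof (induction P)
  case (add x P)
  have "(\<Sum>k<m. count (add_mset x P) k * f k) = (\<Sum>k<m. count P k * f k + (if k = x then f k else 0))"
    by (intro sum.cong) auto
  also have "\<dots> = (\<Sum>k<m. count P k * f k) + f x"
    using add.prems by (subst sum.distrib) (simp add: sum.delta)
  finally show ?case using add by simp
qed simp

text \<open>
  The multiplicities are the digits of the sum in base \<open>N\<close>.
\<close>
lemma power_sum_mset_inj:
  assumes "size P < N" "size Q < N" "(\<Sum>k\<in>#P. N ^ k) = (\<Sum>k\<in>#Q. N ^ k)"
  shows "P = Q"
proof (rule multiset_eqI)
  fix k
  define m where "m = Suc (Max (insert k (set_mset P \<union> set_mset Q)))"
  have m: "set_mset P \<subseteq> {..<m}" "set_mset Q \<subseteq> {..<m}" "k < m"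
    by (auto simp: m_def less_Suc_eq_le)
  show "count P k = count Q k"
  proof (rule digits_unique[where d = "count P" and d' = "count Q"])
    show "count P k < N" "count Q k < N" for k
      using assms count_le_size[of P k] count_le_size[of Q k] by linarith+
    show "(\<Sum>k<m. count P k * N ^ k) = (\<Sum>k<m. count Q k * N ^ k)"
      using assms(3) m by (simp add: sum_mset_eq_sum_count[of _ m])
  qed (rule m)
qed

lemma position_inj: "inj (position :: 'n::{finite,linorder} \<Rightarrow> nat)"
  by (rule linorder_injI) (metis position_strict_mono order_less_irrefl)

definition minor :: "('n \<Rightarrow> complex) \<Rightarrow> ('n \<Rightarrow> complex) \<Rightarrow> 'n \<times> 'n \<Rightarrow> complex" where
  "minor u v = (\<lambda>(i, j). u i * v j - u j * v i)"

lemma plucker_minor: "plucker (minor u v)"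
  by (simp add: plucker_def minor_def algebra_simps)

text \<open>
  Evaluate at powers \<open>u\<^sub>i = T ^ A i\<close>, \<open>v\<^sub>i = T ^ B i\<close> of a large \<open>T\<close>. The exponents are chosen such that \<open>u\<^sub>i v\<^sub>j\<close>
  dominates \<open>u\<^sub>j v\<^sub>i\<close> for \<open>i < j\<close>, so a product of minors grows like \<open>T ^ ex D\<close>, and such that \<open>ex D\<close>
  encodes the left and right end points of \<open>D\<close>, hence the uncrossed \<open>D\<close> itself. The
  term with the largest exponent therefore dominates all others and its coefficient must vanish.
\<close>
lemma uncrossed_minors_independent:
  fixes b :: "('n::{finite,linorder} \<times> 'n) multiset \<Rightarrow>\<^sub>0 complex"
  assumes uncrossed: "\<And>D. D \<in> Poly_Mapping.keys b \<Longrightarrow> diagram D \<and> \<not> crossed D"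
    and zero: "\<And>u v. (\<And>i. v i \<noteq> 0) \<Longrightarrow> linear_extension (monomial (minor u v)) b = 0"
  shows "b = 0"
proof (rule ccontr)
  assume "b \<noteq> 0"
  let ?K = "Poly_Mapping.keys b"
  have K: "finite ?K" "?K \<noteq> {}" using \<open>b \<noteq> 0\<close> by simp_all
  define N where "N = Suc (Suc (Max ((\<lambda>D. 2 * size D) ` ?K)))"
  have N: "2 * size D < N" if "D \<in> ?K" for D
    using that K unfolding N_def by (simp add: less_Suc_eq_le Max_ge le_SucI)
  define n where "n = card (UNIV :: 'n set)"
  have n: "n > 0" "position i < n" for i :: 'n
    using position_less_card by (auto simp: n_def card_gt_0_iff)
  \<comment> \<open>Disjoint ranges of base \<open>N\<close> digits record the left and the right end points.\<close>
  define A B where "A i = N ^ position i" and "B i = N ^ (n + position i)" for i :: 'n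
  have AB: "A j + B i < A i + B j" if "i < j" for i j
  proof -
    have less: "A i < A j" unfolding A_def using position_strict_mono[OF that] N_def
      by (intro power_strict_increasing) simp_all
    moreover have "N ^ n > 1" using n(1) N_def by (intro one_less_power) simp_all
    then obtain w where "N ^ n = Suc (Suc w)" by (metis One_nat_def less_natE add_Suc plus_1_eq_Suc)
    moreover have "B k = N ^ n * A k" for k by (simp add: A_def B_def power_add)
    ultimately show ?thesis using mult_le_mono2[OF less_imp_le[OF less], of w] less
      by (simp only: mult_Suc)
  qed
  define ex where "ex D = (\<Sum>c\<in>#D. A (fst c) + B (snd c))" for D :: "('n \<times> 'n) multiset"
  have inj: "D = D'" if "D \<in> ?K" "D' \<in> ?K" "ex D = ex D'" for D D'
  proof -
    define P where "P D = image_mset position (image_mset fst D)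
      + image_mset (\<lambda>j. n + position j) (image_mset snd D)" for D :: "('n \<times> 'n) multiset"
    have "(\<Sum>k\<in>#P D. N ^ k) = ex D" for D
      by (simp add: P_def ex_def A_def B_def multiset.map_comp comp_def sum_mset.distrib)
    then have P: "P D = P D'"
      using that N by (intro power_sum_mset_inj[of _ N]) (simp_all add: P_def flip: mult_2)
    have "filter_mset (\<lambda>k. k < n) (P D) = image_mset position (image_mset fst D)"
      "filter_mset (\<lambda>k. \<not> k < n) (P D) = image_mset (\<lambda>j. n + position j) (image_mset snd D)" for D
      unfolding P_def filter_union_mset
      by (simp_all add: filter_mset_image_mset n comp_def)
    with P have "image_mset position (image_mset fst D) = image_mset position (image_mset fst D')"
      "image_mset (\<lambda>j. n + position j) (image_mset snd D) = image_mset (\<lambda>j. n + position j) (image_mset snd D')"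
      by metis+
    moreover have "inj (\<lambda>j :: 'n. n + position j)" using position_inj by (simp add: inj_def)
    ultimately have "image_mset fst D = image_mset fst D'" "image_mset snd D = image_mset snd D'"
      using position_inj multiset.inj_map by (metis injD)+
    then show ?thesis using uncrossed that by (intro uncrossed_determined_by_ends) auto
  qed
  have "Max (ex ` ?K) \<in> ex ` ?K" using K by (intro Max_in) auto
  then obtain M where "M \<in> ?K" "ex M = Max (ex ` ?K)" by force
  then have M: "M \<in> ?K" "\<And>D. D \<in> ?K \<Longrightarrow> ex D \<le> ex M" using K by simp_all
  define z where "z T = minor (\<lambda>i. of_nat T ^ A i) (\<lambda>i. of_nat T ^ B i)" for T :: nat
  have lim_chord: "(\<lambda>T. z T c / of_nat T ^ (A (fst c) + B (snd c))) \<longlonglongrightarrow> 1"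
    if chord: "c \<in> chords" for c
  proof -
    obtain i j where c: "c = (i, j)" "i < j" using chord by (auto simp: chords_def)
    obtain w where w: "A i + B j = A j + B i + Suc w" using AB[OF c(2)] by (metis less_natE add_Suc_right)
    have "(\<lambda>T. 1 - inverse (of_nat T) ^ Suc w :: complex) \<longlonglongrightarrow> 1 - 0 ^ Suc w"
      by (intro tendsto_intros lim_inverse_n)
    moreover have "\<forall>\<^sub>F T in sequentially. 1 - inverse (of_nat T) ^ Suc w
        = z T c / of_nat T ^ (A (fst c) + B (snd c))"
    proof (rule eventually_mono[OF eventually_gt_at_top[of 0]])
      fix T :: nat assume T: "0 < T"
      have frac: "1 - inverse q = (p * q - p) / (p * q)" if "p \<noteq> 0" "q \<noteq> 0" for p q :: complex
        using that by (simp add: field_simps)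
      have "z T c = of_nat T ^ (A i + B j) - of_nat T ^ (A j + B i)"
        by (simp add: z_def minor_def c power_add)
      also have "\<dots> = of_nat T ^ (A j + B i) * of_nat T ^ Suc w - of_nat T ^ (A j + B i)"
        unfolding w power_add[of _ _ "Suc w"] ..
      moreover have "A (fst c) + B (snd c) = A j + B i + Suc w" using w by (simp add: c)
      ultimately show "1 - inverse (of_nat T) ^ Suc w = z T c / of_nat T ^ (A (fst c) + B (snd c))"
        using T frac[of "of_nat T ^ (A j + B i)" "of_nat T ^ Suc w"]
        by (simp only: power_add[of _ _ "Suc w"] power_inverse) simp
    qed
    ultimately show ?thesis using Lim_transform_eventually by fastforce
  qed
  have lim: "(\<lambda>T. monomial (z T) D / of_nat T ^ ex D) \<longlonglongrightarrow> 1" if "diagram D" for D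
    using that
  proof (induction D)
    case (add c D)
    have "(\<lambda>T. z T c / of_nat T ^ (A (fst c) + B (snd c)) * (monomial (z T) D / of_nat T ^ ex D))
        \<longlonglongrightarrow> 1 * 1"
      using add by (intro tendsto_mult lim_chord) (auto simp: diagram_def)
    then show ?case by (simp add: ex_def power_add)
  qed (simp add: ex_def)
  have "(\<lambda>T. \<Sum>D\<in>?K. Poly_Mapping.lookup b D * (monomial (z T) D / of_nat T ^ ex M))
      \<longlonglongrightarrow> (\<Sum>D\<in>?K. Poly_Mapping.lookup b D * (if D = M then 1 else 0))"
  proof (intro tendsto_sum tendsto_mult tendsto_const)
    fix D assume D: "D \<in> ?K"
    show "(\<lambda>T. monomial (z T) D / of_nat T ^ ex M) \<longlonglongrightarrow> (if D = M then 1 else 0)"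
    proof (cases "D = M")
      case True
      then show ?thesis using lim[of M] uncrossed[OF D] by simp
    next
      case False
      then have "ex D < ex M" using M D inj by (metis le_neq_implies_less)
      then obtain w where w: "ex M = ex D + Suc w" by (metis less_natE add_Suc_right)
      have "(\<lambda>T. monomial (z T) D / of_nat T ^ ex D * inverse (of_nat T) ^ Suc w) \<longlonglongrightarrow> 1 * 0 ^ Suc w"
        using uncrossed[OF D] by (intro tendsto_mult lim tendsto_power lim_inverse_n) auto
      then show ?thesis using False
        by (simp add: w power_add divide_inverse power_inverse mult_ac)
    qed
  qed
  moreover have "\<forall>\<^sub>F T in sequentially.
      (\<Sum>D\<in>?K. Poly_Mapping.lookup b D * (monomial (z T) D / of_nat T ^ ex M)) = 0"
  proof (rule eventually_mono[OF eventually_gt_at_top[of 0]])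
    fix T :: nat assume "0 < T"
    then have "linear_extension (monomial (z T)) b = 0"
      unfolding z_def by (intro zero) simp
    then show "(\<Sum>D\<in>?K. Poly_Mapping.lookup b D * (monomial (z T) D / of_nat T ^ ex M)) = 0"
      by (simp add: linear_extension_def cscale_complex_def flip: sum_divide_distrib)
  qed
  then have "(\<lambda>T. \<Sum>D\<in>?K. Poly_Mapping.lookup b D * (monomial (z T) D / of_nat T ^ ex M)) \<longlonglongrightarrow> 0"
    by (rule tendsto_eventually)
  ultimately have "(\<Sum>D\<in>?K. Poly_Mapping.lookup b D * (if D = M then 1 else 0)) = 0"
    by (rule LIMSEQ_unique)
  also have "(\<Sum>D\<in>?K. Poly_Mapping.lookup b D * (if D = M then 1 else 0))
      = (\<Sum>D\<in>?K. if D = M then Poly_Mapping.lookup b D else 0)"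
    by (intro sum.cong) simp_all
  finally show False using M(1) K(1) by (simp add: in_keys_iff sum.delta)
qed

text \<open>
  Straightening turns crossed terms into uncrossed ones of strictly smaller weight, which are different
  from the uncrossed term \<open>N m\<close> of maximal weight. So \<open>a m\<close> survives as its coefficient in a vanishing
  combination of uncrossed products.
\<close>
lemma top_uncrossed_coefficient_zero:
  fixes N :: "'i \<Rightarrow> ('n::{finite,linorder} \<times> 'n) multiset"
  assumes I: "finite I" "inj_on N I" "\<And>i. i \<in> I \<Longrightarrow> diagram (N i)"
    and zero: "\<And>u v. (\<And>i. v i \<noteq> 0) \<Longrightarrow> (\<Sum>i\<in>I. a i * monomial (minor u v) (N i)) = 0"
    and m: "m \<in> I" "\<not> crossed (N m)" "\<And>i. i \<in> I \<Longrightarrow> weight (N i) \<le> weight (N m)"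
  shows "a m = 0"
proof -
  have "\<exists>b. (\<forall>M\<in>Poly_Mapping.keys b. diagram M \<and> \<not> crossed M) \<and>
      (\<forall>z. plucker z \<longrightarrow> linear_extension (monomial z) b = monomial z (N i)) \<and>
      Poly_Mapping.lookup b (N m) = (if i = m then 1 else 0)" if i: "i \<in> I" for i
  proof (cases "crossed (N i)")
    case True
    obtain b where b: "\<forall>M\<in>Poly_Mapping.keys b. diagram M \<and> \<not> crossed M \<and> weight M < weight (N i)"
      "\<forall>z. plucker z \<longrightarrow> linear_extension (monomial z) b = monomial z (N i)"
      using straightening[OF I(3)[OF i] True] by blast
    have "N m \<notin> Poly_Mapping.keys b" using b(1) m(3)[OF i] by (auto simp: not_less)
    then have "Poly_Mapping.lookup b (N m) = (if i = m then 1 else 0)"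
      using True m(2) by (auto simp: in_keys_iff)
    with b show ?thesis by blast
  next
    case False
    then show ?thesis
      using i I m by (intro exI[of _ "Poly_Mapping.single (N i) 1"])
        (auto simp: cscale_complex_def lookup_single when_def dest: inj_onD)
  qed
  then obtain b where b: "\<And>i M. i \<in> I \<Longrightarrow> M \<in> Poly_Mapping.keys (b i) \<Longrightarrow> diagram M \<and> \<not> crossed M"
    "\<And>i z. i \<in> I \<Longrightarrow> plucker z \<Longrightarrow> linear_extension (monomial z) (b i) = monomial z (N i)"
    "\<And>i. i \<in> I \<Longrightarrow> Poly_Mapping.lookup (b i) (N m) = (if i = m then 1 else 0)"
    by metis
  define B where "B = (\<Sum>i\<in>I. Poly_Mapping.map ((*) (a i)) (b i))"
  have lookup_B: "Poly_Mapping.lookup B M = (\<Sum>i\<in>I. a i * Poly_Mapping.lookup (b i) M)" for M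
    by (simp add: B_def lookup_sum Poly_Mapping.map.rep_eq when_def) (metis mult_zero_right)
  have "B = 0"
  proof (rule uncrossed_minors_independent)
    fix M assume "M \<in> Poly_Mapping.keys B"
    then have "\<exists>i\<in>I. Poly_Mapping.lookup (b i) M \<noteq> 0"
      by (metis (mono_tags, lifting) in_keys_iff lookup_B mult_zero_right sum.neutral)
    then show "diagram M \<and> \<not> crossed M" using b(1) by (auto simp: in_keys_iff)
  next
    fix u v :: "'n \<Rightarrow> complex" assume "\<And>i. v i \<noteq> 0"
    then have "(\<Sum>i\<in>I. a i * monomial (minor u v) (N i)) = 0" by (rule zero)
    moreover have "linear_extension f (Poly_Mapping.map ((*) c) p) = c * linear_extension f p"
      for f c and p :: "('n \<times> 'n) multiset \<Rightarrow>\<^sub>0 complex"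
    proof -
      have lookup: "Poly_Mapping.lookup (Poly_Mapping.map ((*) c) p) k = c * Poly_Mapping.lookup p k" for k
        by (simp add: Poly_Mapping.map.rep_eq when_def)
      then have "Poly_Mapping.keys (Poly_Mapping.map ((*) c) p) \<subseteq> Poly_Mapping.keys p"
        by (auto simp: in_keys_iff)
      then show ?thesis
        by (simp add: linear_extension_superset[of "Poly_Mapping.keys p"] cscale_complex_def lookup
          sum_distrib_left mult.assoc)
    qed
    ultimately show "linear_extension (monomial (minor u v)) B = 0"
      by (simp add: B_def linear_extension_sum b(2) plucker_minor)
  qed
  then have "(\<Sum>i\<in>I. a i * Poly_Mapping.lookup (b i) (N m)) = 0"
    by (simp flip: lookup_B)
  also have "(\<Sum>i\<in>I. a i * Poly_Mapping.lookup (b i) (N m)) = (\<Sum>i\<in>I. if i = m then a i else 0)"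
    by (intro sum.cong) (simp_all add: b(3))
  finally show ?thesis using I(1) m(1) by (simp add: sum.delta)
qed


section \<open>Leading symbols and linear independence\<close>

text \<open>
  The coefficient of \<open>\<theta>\<^sub>S\<close> in the product of the elements \<open>\<ell>\<^sub>c + 1/2 \<theta>\<^sub>i \<theta>\<^sub>j\<close> over the chords \<open>c = (i, j)\<close> in the
  list, where \<open>\<ell>\<^sub>c\<close> is the minor of \<open>c\<close>.
\<close>
fun symbol :: "('n::linorder \<Rightarrow> complex) \<Rightarrow> ('n \<Rightarrow> complex) \<Rightarrow> ('n \<times> 'n) list \<Rightarrow> 'n set \<Rightarrow> complex" where
  "symbol u v [] S = (if S = {} then 1 else 0)"
| "symbol u v ((i, j) # cs) S = minor u v (i, j) * symbol u v cs S +
     (if i \<in> S \<and> j \<in> S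
      then 1/2 * exchange_sign i S * exchange_sign j (flip i S) * symbol u v cs (flip j (flip i S))
      else 0)"

lemma symbol_empty: "symbol u v cs {} = monomial (minor u v) (mset cs)"
  by (induction cs) auto

text \<open>
  The part of degree two in \<open>\<theta>\<close> of a product is a first order Taylor term, so its coefficients are the
  partial derivatives of the monomial.
\<close>
lemma symbol_pair:
  fixes i j :: "'n::linorder"
  assumes "i < j" "set cs \<subseteq> chords"
  shows "symbol u v cs {i, j} =
    1/2 * of_nat (count (mset cs) (i, j)) * monomial (minor u v) (mset cs - {#(i, j)#})"
  using assms(2)
proof (induction cs)
  case (Cons c cs)
  obtain p q where c: "c = (p, q)" "p < q" using Cons.prems by (cases c) (auto simp: chords_def)
  show ?case
  proof (cases "c = (i, j)")
    case True
    have "{k \<in> {i, j}. k < i} = {}" "flip i {i, j} = {j}" "{k \<in> {j}. k < j} = {}" "flip j {j} = {}"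
      using assms(1) by (auto simp: flip_def)
    then have sgn: "exchange_sign i {i, j} = 1" "exchange_sign j {j} = 1" "flip i {i, j} = {j}" "flip j {j} = {}"
      by (simp_all only: exchange_sign_def card.empty power_0)
    have absorb: "minor u v (i, j) * (of_nat (count (mset cs) (i, j)) * monomial (minor u v) (mset cs - {#(i, j)#}))
        = of_nat (count (mset cs) (i, j)) * monomial (minor u v) (mset cs)"
    proof (cases "(i, j) \<in># mset cs")
      case True
      then obtain R where "mset cs = add_mset (i, j) R" by (meson multi_member_split)
      then show ?thesis by simp
    next
      case False
      then show ?thesis by (simp add: count_eq_zero_iff)
    qed
    have "symbol u v cs {i, j} =
        1/2 * of_nat (count (mset cs) (i, j)) * monomial (minor u v) (mset cs - {#(i, j)#})"
      using Cons by simp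
    then have "symbol u v (c # cs) {i, j} =
        1/2 * (minor u v (i, j) * (of_nat (count (mset cs) (i, j)) * monomial (minor u v) (mset cs - {#(i, j)#})))
        + 1/2 * monomial (minor u v) (mset cs)"
      by (simp add: True sgn symbol_empty)
    then show ?thesis
      unfolding absorb by (simp add: True algebra_simps)
  next
    case False
    then have outside: "\<not> (p \<in> {i, j} \<and> q \<in> {i, j})" using c assms(1) by auto
    have absorb: "of_nat (count (mset cs) (i, j)) * (minor u v c * monomial (minor u v) (mset cs - {#(i, j)#}))
        = of_nat (count (mset cs) (i, j)) * monomial (minor u v) (add_mset c (mset cs) - {#(i, j)#})"
    proof (cases "(i, j) \<in># mset cs")
      case True
      then obtain R where "mset cs = add_mset (i, j) R" by (meson multi_member_split)
      then show ?thesis using False by (simp add: add_mset_commute[of c])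
    next
      case False
      then show ?thesis by (simp add: count_eq_zero_iff)
    qed
    have "symbol u v cs {i, j} =
        1/2 * of_nat (count (mset cs) (i, j)) * monomial (minor u v) (mset cs - {#(i, j)#})"
      using Cons by simp
    then have "symbol u v (c # cs) {i, j} = 1/2 *
        (of_nat (count (mset cs) (i, j)) * (minor u v c * monomial (minor u v) (mset cs - {#(i, j)#})))"
      by (simp only: c(1) symbol.simps outside if_False) simp
    then show ?thesis
      unfolding absorb using False by simp
  qed
qed (use assms(1) in simp)

text \<open>
  Expresses that \<open>f\<close> has degree at most \<open>2 d\<close> with leading form \<open>F\<close> in direction \<open>\<sigma>\<close>, where \<open>s\<close> has
  degree two and each \<open>\<theta>\<^sub>i\<close> degree one. The offset \<open>c\<close> makes the notion insensitive to the shifts by which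
  \<open>x\<^sub>i\<close> and \<open>y\<^sub>i\<close> act, so that no polynomials need to be handled.
\<close>
definition scaled_limit :: "('n \<Rightarrow> complex) \<Rightarrow> nat \<Rightarrow> (('n \<Rightarrow> complex) \<times> 'n set \<Rightarrow> complex) \<Rightarrow>
    ('n set \<Rightarrow> complex) \<Rightarrow> bool" where
  "scaled_limit \<sigma> d f F \<longleftrightarrow> (\<forall>c S. (\<lambda>t::nat. f (\<lambda>i. of_nat t ^ 2 * \<sigma> i + c i, S) *
     of_nat t ^ card S / of_nat t ^ (2 * d)) \<longlonglongrightarrow> F S)"

lemma inverse_power_limit: "(\<lambda>t::nat. 1 / of_nat t ^ Suc k :: complex) \<longlonglongrightarrow> 0"
proof -
  have "(\<lambda>t::nat. inverse (of_nat t) ^ Suc k :: complex) \<longlonglongrightarrow> 0 ^ Suc k"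
    by (intro tendsto_power lim_inverse_n)
  then show ?thesis by (simp add: power_inverse divide_inverse)
qed

lemma scaled_limit_degree:
  assumes "scaled_limit \<sigma> d f F" "d < d'"
  shows "scaled_limit \<sigma> d' f (\<lambda>_. 0)"
  unfolding scaled_limit_def
proof (intro allI)
  fix c S
  obtain k where k: "2 * d' = 2 * d + Suc k" using assms(2) by (metis less_natE add_Suc_right mult_2 add_less_mono)
  have "(\<lambda>t::nat. (f (\<lambda>i. of_nat t ^ 2 * \<sigma> i + c i, S) * of_nat t ^ card S / of_nat t ^ (2 * d)) *
      (1 / of_nat t ^ Suc k)) \<longlonglongrightarrow> F S * 0"
    using assms(1) unfolding scaled_limit_def by (intro tendsto_mult inverse_power_limit) blast
  then show "(\<lambda>t::nat. f (\<lambda>i. of_nat t ^ 2 * \<sigma> i + c i, S) * of_nat t ^ card S / of_nat t ^ (2 * d'))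
      \<longlonglongrightarrow> 0"
    unfolding k by (simp only: power_add times_divide_times_eq mult_1_right mult_zero_right)
qed

lemma card_flip_flip:
  fixes S :: "'n::finite set"
  assumes "i \<noteq> j"
  shows "if i \<in> S \<and> j \<in> S then card (flip j (flip i S)) + 2 = card S
    else \<exists>k. card (flip j (flip i S)) + 2 = card S + Suc k"
proof -
  have flip: "card (flip i S) = (if i \<in> S then card S - 1 else card S + 1)" for i and S :: "'n set"
    by (simp add: flip_def)
  have "i \<in> S \<or> j \<in> S \<Longrightarrow> card S > 0" by (auto simp: card_gt_0_iff)
  moreover have "card S > 1" if "i \<in> S" "j \<in> S"
    using that assms card_mono[of S "{i, j}"] by simp
  moreover have "j \<in> flip i S \<longleftrightarrow> j \<in> S" using assms by (auto simp: flip_def)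
  ultimately show ?thesis by (auto simp: flip)
qed

text \<open>
  The offset absorbs the shifts, and \<open>s\<^sub>p / t\<^sup>2\<close> tends to \<open>\<sigma>\<^sub>p\<close>, so \<open>x\<^sub>p y\<^sub>q\<close> contributes \<open>u\<^sub>p a\<^sub>q\<close>. In
  \<open>1/2 e\<^sub>i e\<^sub>j\<close> only multiplication by \<open>\<theta>\<^sub>i \<theta>\<^sub>j\<close> raises the degree by two; the parts that involve a derivative
  in some \<open>\<theta>\<close> have lower degree and disappear in the limit.
\<close>
lemma scaled_limit_Oel:
  fixes a \<sigma> :: "'n::{finite,linorder} \<Rightarrow> complex"
  assumes f: "scaled_limit \<sigma> d f (symbol u a cs)" and a: "\<And>i. a i \<noteq> 0"
    and \<sigma>: "\<And>i. \<sigma> i = u i * a i" and ij: "i \<noteq> j"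
  shows "scaled_limit \<sigma> (Suc d)
    (apply_op (op_x a i * op_y a j - op_x a j * op_y a i + (1/2) *\<^sub>C (op_e i * op_e j)) f)
    (symbol u a ((i, j) # cs))"
  unfolding scaled_limit_def
proof (intro allI)
  fix c :: "'n \<Rightarrow> complex" and S :: "'n set"
  define s where "s t = (\<lambda>i. of_nat t ^ 2 * \<sigma> i + c i)" for t :: nat
  have xy: "(\<lambda>t. apply_op (op_x a p * op_y a q) f (s t, S) * of_nat t ^ card S / of_nat t ^ (2 * Suc d))
      \<longlonglongrightarrow> u p * a q * symbol u a cs S" if "p \<noteq> q" for p q
  proof -
    define c' where "c' = c(p := c p - 1, q := c q + 1)"
    have s': "(s t)(p := s t p - 1, q := s t q + 1) = (\<lambda>i. of_nat t ^ 2 * \<sigma> i + c' i)" for t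
      using that by (auto simp: s_def c'_def)
    have "(\<lambda>t::nat. (\<sigma> p + c p * (1 / of_nat t ^ Suc 1)) / a p * a q *
        (f (\<lambda>i. of_nat t ^ 2 * \<sigma> i + c' i, S) * of_nat t ^ card S / of_nat t ^ (2 * d)))
        \<longlonglongrightarrow> (\<sigma> p + c p * 0) / a p * a q * symbol u a cs S"
      using f a unfolding scaled_limit_def by (intro tendsto_intros inverse_power_limit) blast+
    moreover have "\<forall>\<^sub>F t in sequentially. (\<sigma> p + c p * (1 / of_nat t ^ Suc 1)) / a p * a q *
        (f (\<lambda>i. of_nat t ^ 2 * \<sigma> i + c' i, S) * of_nat t ^ card S / of_nat t ^ (2 * d)) =
        apply_op (op_x a p * op_y a q) f (s t, S) * of_nat t ^ card S / of_nat t ^ (2 * Suc d)"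
    proof (rule eventually_mono[OF eventually_gt_at_top[of 0]])
      fix t :: nat assume t: "0 < t"
      have "apply_op (op_x a p * op_y a q) f (s t, S)
          = s t p / a p * a q * f (\<lambda>i. of_nat t ^ 2 * \<sigma> i + c' i, S)"
        using that by (simp add: times_operator.rep_eq op_x.rep_eq op_y.rep_eq flip: s')
      moreover have "s t p = (\<sigma> p + c p * (1 / of_nat t ^ Suc 1)) * of_nat t ^ 2"
        using t by (simp add: s_def field_simps power2_eq_square)
      ultimately show "(\<sigma> p + c p * (1 / of_nat t ^ Suc 1)) / a p * a q *
        (f (\<lambda>i. of_nat t ^ 2 * \<sigma> i + c' i, S) * of_nat t ^ card S / of_nat t ^ (2 * d)) =
        apply_op (op_x a p * op_y a q) f (s t, S) * of_nat t ^ card S / of_nat t ^ (2 * Suc d)"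
        using t by (simp add: power2_eq_square)
    qed
    ultimately have "(\<lambda>t. apply_op (op_x a p * op_y a q) f (s t, S) * of_nat t ^ card S / of_nat t ^ (2 * Suc d))
      \<longlonglongrightarrow> (\<sigma> p + c p * 0) / a p * a q * symbol u a cs S"
      by (rule Lim_transform_eventually)
    then show ?thesis using a[of p] by (simp add: \<sigma>)
  qed
  define S' where "S' = flip j (flip i S)"
  define E where "E = exchange_sign i S * exchange_sign j (flip i S)"
  have e_eq: "apply_op (op_e i * op_e j) f (s t, S) = E * f (s t, S')" for t
    by (simp add: times_operator.rep_eq op_e.rep_eq E_def S'_def)
  have fS': "(\<lambda>t. E * (f (s t, S') * of_nat t ^ card S' / of_nat t ^ (2 * d))) \<longlonglongrightarrow> E * symbol u a cs S'"
    using f unfolding scaled_limit_def s_def by (intro tendsto_intros) blast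
  have ee: "(\<lambda>t. apply_op (op_e i * op_e j) f (s t, S) * of_nat t ^ card S / of_nat t ^ (2 * Suc d))
      \<longlonglongrightarrow> (if i \<in> S \<and> j \<in> S then E * symbol u a cs S' else 0)"
  proof (cases "i \<in> S \<and> j \<in> S")
    case True
    then have card: "card S = card S' + 2" using card_flip_flip[OF ij, of S] by (simp add: S'_def)
    have "\<forall>\<^sub>F t in sequentially. E * (f (s t, S') * of_nat t ^ card S' / of_nat t ^ (2 * d)) =
        apply_op (op_e i * op_e j) f (s t, S) * of_nat t ^ card S / of_nat t ^ (2 * Suc d)"
      by (rule eventually_mono[OF eventually_gt_at_top[of 0]])
        (simp add: e_eq card power2_eq_square)
    with fS' show ?thesis using True by (auto intro: Lim_transform_eventually)
  next
    case False
    then obtain k where card: "card S' + 2 = card S + Suc k"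
      using card_flip_flip[OF ij, of S] by (auto simp: S'_def)
    have "(\<lambda>t. E * (f (s t, S') * of_nat t ^ card S' / of_nat t ^ (2 * d)) * (1 / of_nat t ^ Suc k))
        \<longlonglongrightarrow> E * symbol u a cs S' * 0"
      by (intro tendsto_mult[OF fS'] inverse_power_limit)
    moreover have "\<forall>\<^sub>F t in sequentially.
        E * (f (s t, S') * of_nat t ^ card S' / of_nat t ^ (2 * d)) * (1 / of_nat t ^ Suc k) =
        apply_op (op_e i * op_e j) f (s t, S) * of_nat t ^ card S / of_nat t ^ (2 * Suc d)"
    proof (rule eventually_mono[OF eventually_gt_at_top[of 0]])
      fix t :: nat assume t: "0 < t"
      have pow: "(of_nat t :: complex) ^ card S' * of_nat t ^ 2 = of_nat t ^ card S * of_nat t ^ Suc k"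
        using card by (simp only: flip: power_add)
      have pow_Suc: "(of_nat t :: complex) ^ (2 * Suc d) = of_nat t ^ (2 * d) * of_nat t ^ 2"
        by (simp flip: power_add)
      have frac: "e * (g * p / r) * (1 / w) = (e * g) * q / (r * m)"
        if "p * m = q * w" "w \<noteq> 0" "m \<noteq> 0" for e g p q r w m :: complex
      proof -
        have "p / w = q / m" using that by (simp add: frac_eq_eq)
        have "e * (g * p / r) * (1 / w) = e * g / r * (p / w)" by simp
        also have "\<dots> = (e * g) * q / (r * m)" unfolding \<open>p / w = q / m\<close> by simp
        finally show ?thesis .
      qed
      show "E * (f (s t, S') * of_nat t ^ card S' / of_nat t ^ (2 * d)) * (1 / of_nat t ^ Suc k) =
        apply_op (op_e i * op_e j) f (s t, S) * of_nat t ^ card S / of_nat t ^ (2 * Suc d)"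
        unfolding e_eq pow_Suc by (rule frac[OF pow]) (use t in simp_all)
    qed
    ultimately show ?thesis using False by (auto intro: Lim_transform_eventually)
  qed
  have "(\<lambda>t. apply_op (op_x a i * op_y a j) f (s t, S) * of_nat t ^ card S / of_nat t ^ (2 * Suc d)
      - apply_op (op_x a j * op_y a i) f (s t, S) * of_nat t ^ card S / of_nat t ^ (2 * Suc d)
      + 1/2 * (apply_op (op_e i * op_e j) f (s t, S) * of_nat t ^ card S / of_nat t ^ (2 * Suc d)))
     \<longlonglongrightarrow> u i * a j * symbol u a cs S - u j * a i * symbol u a cs S
      + 1/2 * (if i \<in> S \<and> j \<in> S then E * symbol u a cs S' else 0)"
    using ij by (intro tendsto_add tendsto_diff tendsto_mult tendsto_const xy ee) auto
  moreover have "u i * a j * symbol u a cs S - u j * a i * symbol u a cs S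
      + 1/2 * (if i \<in> S \<and> j \<in> S then E * symbol u a cs S' else 0) = symbol u a ((i, j) # cs) S"
    by (simp add: minor_def E_def S'_def algebra_simps)
  moreover have "apply_op (op_x a i * op_y a j) f z * p / q - apply_op (op_x a j * op_y a i) f z * p / q
      + 1/2 * (apply_op (op_e i * op_e j) f z * p / q) =
      apply_op (op_x a i * op_y a j - op_x a j * op_y a i + (1/2) *\<^sub>C (op_e i * op_e j)) f z * p / q" for z p q
    by (simp add: plus_operator.rep_eq minus_operator.rep_eq cscale_operator.rep_eq
        add_divide_distrib diff_divide_distrib algebra_simps)
  ultimately show "(\<lambda>t. apply_op (op_x a i * op_y a j - op_x a j * op_y a i + (1/2) *\<^sub>C (op_e i * op_e j)) f
      (\<lambda>i. of_nat t ^ 2 * \<sigma> i + c i, S) * of_nat t ^ card S / of_nat t ^ (2 * Suc d))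
      \<longlonglongrightarrow> symbol u a ((i, j) # cs) S"
    by (simp only: flip: s_def)
qed

abbreviation Oel_prod :: "('n \<times> 'n) list \<Rightarrow> ('n weyl, 'n clifford) tensor" where
  "Oel_prod cs \<equiv> prod_list (map (\<lambda>(i, j). Oel i j) cs)"

text \<open>
  Only diagrams of the largest size \<open>d\<close> contribute to the leading symbol. Its value at the empty set
  and at \<open>{i, j}\<close> gives the vanishing of a polynomial in the minors and of its derivative with respect to
  the chord \<open>(i, j)\<close>; an occurring diagram of maximal weight contradicts one of the two.
\<close>
lemma uncrossable_products_independent:
  fixes a :: "('n::{finite,linorder} \<times> 'n) multiset \<Rightarrow> complex"
  assumes "finite \<D>" "\<And>D. D \<in> \<D> \<Longrightarrow> uncrossable D" "\<And>D. D \<in> \<D> \<Longrightarrow> mset (ls D) = D"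
    and zero: "(\<Sum>D\<in>\<D>. a D *\<^sub>C Oel_prod (ls D)) = 0"
  shows "\<forall>D\<in>\<D>. a D = 0"
proof (rule ccontr)
  assume "\<not> (\<forall>D\<in>\<D>. a D = 0)"
  define K where "K = {D \<in> \<D>. a D \<noteq> 0}"
  have K: "finite K" "K \<noteq> {}" using assms(1) \<open>\<not> _\<close> by (auto simp: K_def)
  have zero_K: "(\<Sum>D\<in>K. a D *\<^sub>C Oel_prod (ls D)) = 0"
    unfolding zero[symmetric] using assms(1) by (intro sum.mono_neutral_left) (auto simp: K_def)
  have dia: "diagram D" if "D \<in> K" for D using that assms(2) by (auto simp: K_def uncrossable_def)
  have ls: "mset (ls D) = D" "set (ls D) \<subseteq> chords" if "D \<in> K" for D
    using that assms(3)[of D] dia[OF that] by (auto simp: K_def diagram_def simp flip: set_mset_mset)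
  define d where "d = Max (size ` K)"
  define I where "I = {D \<in> K. size D = d}"
  have "d \<in> size ` K" unfolding d_def using K by (intro Max_in) auto
  then have I: "finite I" "I \<noteq> {}" "I \<subseteq> K" using K by (auto simp: I_def)
  have le_d: "size D \<le> d" if "D \<in> K" for D unfolding d_def using that K by simp
  have symbol_zero: "(\<Sum>D\<in>I. a D * symbol u v (ls D) S) = 0" if v: "\<And>i. v i \<noteq> 0" for u v S
  proof -
    obtain h :: "('n weyl, 'n clifford) tensor \<Rightarrow> (('n \<Rightarrow> complex) \<times> 'n set) operator"
      where h: "algebra_hom h" "\<And>i j. h (Oel i j) =
        op_x v i * op_y v j - op_x v j * op_y v i + (1/2) *\<^sub>C (op_e i * op_e j)"
      using tensor_representation[of v, OF v] by metis
    interpret h: algebra_hom h by (rule h)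
    \<comment> \<open>With \<open>a = v\<close>, the symbol \<open>\<sigma>\<^sub>i / a\<^sub>i\<close> of \<open>x\<^sub>i\<close> is \<open>u\<^sub>i\<close>.\<close>
    define \<sigma> where "\<sigma> i = u i * v i" for i
    define v0 where "v0 = (\<lambda>(s :: 'n \<Rightarrow> complex, S :: 'n set). if S = {} then 1 else 0 :: complex)"
    have lim: "scaled_limit \<sigma> (length cs) (apply_op (h (Oel_prod cs)) v0) (symbol u v cs)"
      if "set cs \<subseteq> chords" for cs
      using that
    proof (induction cs)
      case Nil
      then show ?case by (simp add: scaled_limit_def h.one one_operator.rep_eq v0_def)
    next
      case (Cons c cs)
      obtain i j where c: "c = (i, j)" "i < j" using Cons.prems by (cases c) (auto simp: chords_def)
      have "scaled_limit \<sigma> (Suc (length cs))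
        (apply_op (op_x v i * op_y v j - op_x v j * op_y v i + (1/2) *\<^sub>C (op_e i * op_e j))
          (apply_op (h (Oel_prod cs)) v0)) (symbol u v ((i, j) # cs))"
        by (rule scaled_limit_Oel[OF _ v \<sigma>_def]) (use Cons c in auto)
      then show ?case by (simp add: c h.mult times_operator.rep_eq h(2) del: symbol.simps)
    qed
    let ?f = "\<lambda>D. apply_op (h (Oel_prod (ls D))) v0"
    have "(\<lambda>t::nat. \<Sum>D\<in>K. a D * (?f D (\<lambda>i. of_nat t ^ 2 * \<sigma> i + 0, S) * of_nat t ^ card S / of_nat t ^ (2 * d)))
        \<longlonglongrightarrow> (\<Sum>D\<in>K. a D * (if size D = d then symbol u v (ls D) S else 0))"
    proof (intro tendsto_sum tendsto_mult tendsto_const)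
      fix D assume D: "D \<in> K"
      then have len: "length (ls D) = size D" using ls(1) by (metis size_mset)
      have "scaled_limit \<sigma> d (?f D) (if size D = d then symbol u v (ls D) else (\<lambda>_. 0))"
        using lim[OF ls(2)[OF D]] scaled_limit_degree[OF lim[OF ls(2)[OF D]], of d] le_d[OF D] len by auto
      from this[unfolded scaled_limit_def, rule_format, of "\<lambda>_. 0" S]
      show "(\<lambda>t::nat. ?f D (\<lambda>i. of_nat t ^ 2 * \<sigma> i + 0, S) * of_nat t ^ card S / of_nat t ^ (2 * d))
        \<longlonglongrightarrow> (if size D = d then symbol u v (ls D) S else 0)"
        by (cases "size D = d") simp_all
    qed
    moreover have "(\<Sum>D\<in>K. a D * (?f D z * p / q)) = 0" for z p q
    proof -
      have apply_sum: "apply_op (\<Sum>D\<in>K. g D) v0 z = (\<Sum>D\<in>K. apply_op (g D) v0 z)"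
        for g :: "_ \<Rightarrow> (('n \<Rightarrow> complex) \<times> 'n set) operator"
        by (induction K rule: infinite_finite_induct) (simp_all add: zero_operator.rep_eq plus_operator.rep_eq)
      have "(\<Sum>D\<in>K. a D * ?f D z) = apply_op (h (\<Sum>D\<in>K. a D *\<^sub>C Oel_prod (ls D))) v0 z"
        by (simp add: h.sum h.scale apply_sum cscale_operator.rep_eq)
      then have "(\<Sum>D\<in>K. a D * ?f D z) = 0"
        by (simp add: zero_K h.zero zero_operator.rep_eq)
      moreover have "(\<Sum>D\<in>K. a D * (?f D z * p / q)) = (\<Sum>D\<in>K. a D * ?f D z) * (p / q)"
        by (simp add: sum_distrib_right sum_divide_distrib mult.assoc)
      ultimately show ?thesis by simp
    qed
    ultimately have "(\<lambda>t::nat. 0) \<longlonglongrightarrow> (\<Sum>D\<in>K. a D * (if size D = d then symbol u v (ls D) S else 0))"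
      by simp
    then have "(\<Sum>D\<in>K. a D * (if size D = d then symbol u v (ls D) S else 0)) = 0"
      by (simp add: LIMSEQ_const_iff)
    moreover have "(\<Sum>D\<in>I. a D * symbol u v (ls D) S)
        = (\<Sum>D\<in>K. a D * (if size D = d then symbol u v (ls D) S else 0))"
      using K by (intro sum.mono_neutral_cong_left) (auto simp: I_def)
    ultimately show ?thesis by simp
  qed
  have "Max (weight ` I) \<in> weight ` I" using I by (intro Max_in) auto
  then obtain M where "M \<in> I" "weight M = Max (weight ` I)" by force
  then have M: "M \<in> I" "\<And>D. D \<in> I \<Longrightarrow> weight D \<le> weight M" using I by simp_all
  have aM: "a M \<noteq> 0" and uM: "uncrossable M" using M(1) I assms(2) by (auto simp: K_def I_def)
  show False
  proof (cases "crossed M")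
    case False
    have "a M = 0"
    proof (rule top_uncrossed_coefficient_zero[of I "\<lambda>D. D"])
      fix u v :: "'n \<Rightarrow> complex" assume "\<And>i. v i \<noteq> 0"
      from symbol_zero[OF this, where u = u and S = "{}"]
      show "(\<Sum>D\<in>I. a D * monomial (minor u v) D) = 0"
        using I(3) ls(1) by (simp add: symbol_empty subset_iff cong: sum.cong)
    qed (use I M False dia in auto)
    with aM show False by simp
  next
    case True
    then obtain D' i j where D': "\<not> crossed D'" "i < j" "M = add_mset (i, j) D'"
      using uM by (auto simp: uncrossable_def)
    define I' where "I' = {D \<in> I. (i, j) \<in># D}"
    have vanish: "(\<Sum>D\<in>I'. a D * of_nat (count D (i, j)) * monomial (minor u v) (D - {#(i, j)#})) = 0"
      if v: "\<And>i. v i \<noteq> 0" for u v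
    proof -
      have "(\<Sum>D\<in>I. a D * symbol u v (ls D) {i, j}) =
          (\<Sum>D\<in>I'. 1/2 * (a D * of_nat (count D (i, j)) * monomial (minor u v) (D - {#(i, j)#})))"
      proof (rule sum.mono_neutral_cong_right)
        show "\<forall>D\<in>I - I'. a D * symbol u v (ls D) {i, j} = 0"
          using I(3) ls D'(2) by (auto simp: symbol_pair I'_def count_eq_zero_iff)
      next
        fix D assume "D \<in> I'"
        then have "D \<in> K" using I(3) by (auto simp: I'_def)
        then show "a D * symbol u v (ls D) {i, j} =
            1/2 * (a D * of_nat (count D (i, j)) * monomial (minor u v) (D - {#(i, j)#}))"
          using ls D'(2) by (simp add: symbol_pair)
      qed (use I in \<open>auto simp: I'_def\<close>)
      then show ?thesis
        using symbol_zero[OF v, where u = u and S = "{i, j}"] by (simp flip: sum_divide_distrib sum_distrib_left)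
    qed
    have "a M * of_nat (count M (i, j)) = 0"
    proof (rule top_uncrossed_coefficient_zero[of I' "\<lambda>D. D - {#(i, j)#}" "\<lambda>D. a D * of_nat (count D (i, j))", OF _ _ _ vanish])
      show "inj_on (\<lambda>D. D - {#(i, j)#}) I'"
        by (rule inj_onI) (metis (mono_tags, lifting) I'_def insert_DiffM mem_Collect_eq)
      show "diagram (D - {#(i, j)#})" if "D \<in> I'" for D
        using that I dia by (auto simp: I'_def diagram_def dest: in_diffD)
      show "weight (D - {#(i, j)#}) \<le> weight (M - {#(i, j)#})" if "D \<in> I'" for D
      proof -
        obtain R where "D = add_mset (i, j) R" using \<open>D \<in> I'\<close> by (auto simp: I'_def dest: multi_member_split)
        then show ?thesis using M(2)[of D] that D'(3) by (auto simp: I'_def)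
      qed
    qed (use I M D' in \<open>auto simp: I'_def\<close>)
    moreover have "count M (i, j) \<noteq> 0" by (simp add: D'(3))
    ultimately show False using aM by (metis mult_eq_0_iff of_nat_eq_0_iff)
  qed
qed


section \<open>Orbital and total angular momentum\<close>

text \<open>
  Only the defining relations enter the computations of this part. They are carried out for abstract
  elements in order to avoid the tensor symbols.
\<close>
locale weyl_clifford =
  fixes x y e :: "'n \<Rightarrow> 'a::complex_algebra"
  assumes yx: "y i * x j = x j * y i + (if i = j then 1 else 0)"
    and xx: "x i * x j = x j * x i" and yy: "y i * y j = y j * y i"
    and ex: "e i * x j = x j * e i" and ey: "e i * y j = y j * e i"
    and ee: "e i * e j + e j * e i = (if i = j then 1 + 1 else 0)"
begin

text \<open>
  \<open>L\<close> is orbital and \<open>J\<close> total angular momentum; \<open>E\<close> is the Pluecker expression in the \<open>J i j\<close>.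
\<close>
definition L :: "'n \<Rightarrow> 'n \<Rightarrow> 'a" where
  "L i j = x i * y j - x j * y i"

definition J :: "'n \<Rightarrow> 'n \<Rightarrow> 'a" where
  "J i j = L i j + (1/2) *\<^sub>C (e i * e j)"

definition E :: "'n \<Rightarrow> 'n \<Rightarrow> 'n \<Rightarrow> 'n \<Rightarrow> 'a" where
  "E i j k l = J i j * J k l - J i k * J j l + J i l * J j k"

lemma half_double: "(1/2) *\<^sub>C (a + a) = (a :: 'a)"
proof -
  have "(1/2) *\<^sub>C (a + a) = (1/2 + 1/2 :: complex) *\<^sub>C a"
    by (simp only: cscale_add_right cscale_add_left)
  then show ?thesis by (simp add: cscale_one)
qed

lemma e_square: "e i * e i = 1"
  using ee[of i i] half_double[of "e i * e i"] half_double[of 1] by simp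

lemma e_swap: "i \<noteq> j \<Longrightarrow> e j * e i = - (e i * e j)"
  using ee[of i j] by (simp add: eq_neg_iff_add_eq_0 add.commute)

lemma e_square_left: "e i * (e i * z) = z"
  by (simp add: e_square flip: mult.assoc)

lemma e_swap_left: "i \<noteq> j \<Longrightarrow> e j * (e i * z) = - (e i * (e j * z))"
  using e_swap[of i j] by (metis mult.assoc mult_minus_left)

lemma commute_left: "a * b = b * a \<Longrightarrow> a * (b * z) = b * (a * (z :: 'a))"
  by (simp flip: mult.assoc)

lemma e_L: "e m * L i j = L i j * e m"
  by (simp add: L_def algebra_simps ex ey commute_left[OF ex] commute_left[OF ey])

lemmas e_L_left = commute_left[OF e_L]

lemma L_swap: "L j i = - L i j"
  by (simp add: L_def)

lemma yx_neq: "i \<noteq> j \<Longrightarrow> y i * x j = x j * y i"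
  by (simp add: yx)

lemma yx_eq: "y i * x i = x i * y i + 1"
  by (simp add: yx)

lemma yx_eq_left: "y i * (x i * z) = x i * (y i * z) + z"
  by (simp add: yx_eq distrib_right flip: mult.assoc)

lemmas xy_simps = algebra_simps xx yy yx_neq commute_left[OF xx] commute_left[OF yy]
  commute_left[OF yx_neq] yx_eq yx_eq_left

lemma L_commute:
  assumes "distinct [i, j, k, l]" shows "L i j * L k l = L k l * L i j"
proof -
  note neq = assms[simplified] not_sym[of i j] not_sym[of i k] not_sym[of i l] not_sym[of j k]
    not_sym[of j l] not_sym[of k l]
  show ?thesis using neq by (simp add: L_def xy_simps)
qed

lemma L_bracket:
  assumes "distinct [i, j, k]" shows "L i j * L j k = L j k * L i j + L i k"
proof -
  note neq = assms[simplified] not_sym[of i j] not_sym[of i k] not_sym[of j k]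
  show ?thesis using neq by (simp add: L_def xy_simps)
qed

lemma L_plucker:
  assumes "distinct [i, j, k, l]"
  shows "L i k * L j l = L i j * L k l + L i l * L j k"
proof -
  note neq = assms[simplified] not_sym[of i j] not_sym[of i k] not_sym[of i l] not_sym[of j k]
    not_sym[of j l] not_sym[of k l]
  show ?thesis using neq by (simp add: L_def xy_simps)
qed

lemma J_swap: "i \<noteq> j \<Longrightarrow> J j i = - J i j"
  by (simp add: J_def L_swap[of j i] e_swap[of i j])

lemma J_commute:
  assumes "distinct [i, j, k, l]" shows "J i j * J k l = J k l * J i j"
proof -
  have ne: "i \<noteq> k" "i \<noteq> l" "j \<noteq> k" "j \<noteq> l" using assms by auto
  have "e k * (e l * (e i * e j)) = e i * (e j * (e k * e l))"
    by (simp add: ne[THEN e_swap] ne[THEN e_swap_left])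
  then show ?thesis
    using L_commute[OF assms]
    by (simp add: J_def algebra_simps cscale_mult_left cscale_mult_right e_L e_L_left)
qed

lemma J_bracket:
  assumes "distinct [i, j, k]" shows "J i j * J j k = J j k * J i j + J i k"
proof -
  have ne: "i \<noteq> j" "i \<noteq> k" "j \<noteq> k" using assms by auto
  have 1: "e j * (e k * (e i * e j)) = - (e i * e k)"
    by (simp add: ne[THEN e_swap] ne[THEN e_swap_left] e_square_left)
  have "(1/4) *\<^sub>C (e i * e k) + (1/4) *\<^sub>C (e i * e k) = (1/2) *\<^sub>C (e i * e k)"
    by (simp flip: cvec.scale_left_distrib)
  then show ?thesis
    using L_bracket[OF assms]
    by (simp add: J_def algebra_simps cscale_mult_left cscale_mult_right e_L e_L_left 1 e_square_left)
qed

text \<open>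
  The products of two orbital elements cancel by the Pluecker relation.
\<close>
lemma E_expand:
  assumes "distinct [i, j, k, l]"
  defines "T \<equiv> L i j * (e k * e l) + L k l * (e i * e j) - L i k * (e j * e l) - L j l * (e i * e k)
    + L i l * (e j * e k) + L j k * (e i * e l)"
  shows "E i j k l = (1/2) *\<^sub>C T + (3/4) *\<^sub>C (e i * (e j * (e k * e l)))"
proof -
  have c: "(3/4) *\<^sub>C w = (1/4) *\<^sub>C w + (1/4) *\<^sub>C w + (1/4) *\<^sub>C w" for w :: 'a
    by (simp flip: cvec.scale_left_distrib)
  show ?thesis unfolding c E_def T_def J_def
    using assms(1) L_plucker[OF assms(1)] e_swap_left[of j k] e_swap_left[of j l] e_swap[of k l] e_swap[of j l]
    by (simp add: algebra_simps cscale_mult_left cscale_mult_right e_L e_L_left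
        cvec.scale_right_distrib cvec.scale_left_distrib cvec.scale_right_diff_distrib cscale_cscale)
qed

text \<open>
  Products of terms with complementary index pairs cancel by the Pluecker relation, and terms sharing one index
  combine to commutators because their Clifford parts anticommute.
\<close>
lemma L_e_sum_square:
  assumes "distinct [i, j, k, l]"
  defines "T \<equiv> L i j * (e k * e l) + L k l * (e i * e j) - L i k * (e j * e l) - L j l * (e i * e k)
    + L i l * (e j * e k) + L j k * (e i * e l)"
  defines "Q \<equiv> L i j * (e i * e j) + L i k * (e i * e k) + L i l * (e i * e l)
    + L j k * (e j * e k) + L j l * (e j * e l) + L k l * (e k * e l)"
  shows "T * T = Q + Q - (L i j * L i j + L i k * L i k + L i l * L i l + L j k * L j k + L j l * L j l + L k l * L k l)"
proof -
  have ne: "i \<noteq> j" "i \<noteq> k" "i \<noteq> l" "j \<noteq> k" "j \<noteq> l" "k \<noteq> l" using assms(1) by auto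
  note e = ne[THEN e_swap] ne[THEN e_swap_left] e_square e_square_left
  have d: "distinct [i, j, k, l]" "distinct [i, k, j, l]" "distinct [i, l, j, k]" using ne by auto
  note Lc = d[THEN L_commute]
  note Lp = L_plucker[OF d(1)]
  \<comment> \<open>Rules that bring products of two overlapping orbital elements into lexicographic order.\<close>
  have b: "L i k * L i j = L i j * L i k + L j k"
    "L i l * L i j = L i j * L i l + L j l"
    "L i l * L i k = L i k * L i l + L k l"
    "L j k * L i j = L i j * L j k - L i k"
    "L j l * L i j = L i j * L j l - L i l"
    "L j l * L j k = L j k * L j l + L k l"
    "L j k * L i k = L i k * L j k + L i j"
    "L k l * L i k = L i k * L k l - L i l"
    "L k l * L j k = L j k * L k l - L j l"
    "L j l * L i l = L i l * L j l + L i j"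
    "L k l * L i l = L i l * L k l + L i k"
    "L k l * L j l = L j l * L k l + L j k"
    using ne L_bracket[of j i k] L_bracket[of j i l] L_bracket[of k i l] L_bracket[of i j k]
      L_bracket[of i j l] L_bracket[of k j l] L_bracket[of i k j] L_bracket[of i k l]
      L_bracket[of j k l] L_bracket[of i l j] L_bracket[of i l k] L_bracket[of j l k]
      L_swap[of j i] L_swap[of k i] L_swap[of l i] L_swap[of k j] L_swap[of l j] L_swap[of l k]
    by (simp_all add: algebra_simps)
  have left: "a * b = c \<Longrightarrow> a * (b * z) = c * z" for a b c z :: 'a by (simp flip: mult.assoc)
  note LL = Lc[symmetric] Lp b
  show ?thesis unfolding T_def Q_def
    by (simp add: algebra_simps e e_L e_L_left LL LL[THEN left])
qed

lemma J_square: "i \<noteq> j \<Longrightarrow> J i j * J i j = L i j * L i j + L i j * (e i * e j) - (1/4) *\<^sub>C 1"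
proof -
  assume ij: "i \<noteq> j"
  have "(1/2) *\<^sub>C w + (1/2) *\<^sub>C w = w" for w :: 'a
    using half_double[of w] by (simp add: cvec.scale_right_distrib)
  then show ?thesis
    using ij by (simp add: J_def algebra_simps cscale_mult_left cscale_mult_right e_L e_L_left
      e_swap[OF ij] e_swap_left[OF ij] e_square e_square_left cscale_cscale)
qed

text \<open>
  With \<open>G = e\<^sub>i e\<^sub>j e\<^sub>k e\<^sub>l\<close> one has \<open>E = 1/2 T + 3/4 G\<close>, and multiplication by \<open>G\<close> exchanges \<open>T\<close> with the negative
  of the spin-orbit term \<open>Q = \<Sum> L\<^sub>p\<^sub>q e\<^sub>p e\<^sub>q\<close>. The terms in \<open>Q\<close> and \<open>L\<^sub>p\<^sub>q\<^sup>2\<close> then combine to the quadratic Casimir element of \<open>so(4)\<close>.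
\<close>
lemma E_square:
  assumes "distinct [i, j, k, l]"
  shows "E i j k l * E i j k l = (3/16) *\<^sub>C 1 - (1/4) *\<^sub>C (J i j * J i j + J i k * J i k
    + J i l * J i l + J j k * J j k + J j l * J j l + J k l * J k l)"
proof -
  have ne: "i \<noteq> j" "i \<noteq> k" "i \<noteq> l" "j \<noteq> k" "j \<noteq> l" "k \<noteq> l" using assms(1) by auto
  note e = ne[THEN e_swap] ne[THEN e_swap_left] e_square e_square_left
  define T where "T = L i j * (e k * e l) + L k l * (e i * e j) - L i k * (e j * e l)
    - L j l * (e i * e k) + L i l * (e j * e k) + L j k * (e i * e l)"
  define Q where "Q = L i j * (e i * e j) + L i k * (e i * e k) + L i l * (e i * e l)
    + L j k * (e j * e k) + L j l * (e j * e l) + L k l * (e k * e l)"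
  define S where "S = L i j * L i j + L i k * L i k + L i l * L i l + L j k * L j k + L j l * L j l
    + L k l * L k l"
  define G where "G = e i * (e j * (e k * e l))"
  have GG: "G * G = 1"
    by (simp add: G_def mult.assoc e)
  have TG: "T * G = - Q" "G * T = - Q"
    by (simp_all add: T_def Q_def G_def algebra_simps e e_L e_L_left)
  have TT: "T * T = Q + Q - S"
    unfolding T_def Q_def S_def by (rule L_e_sum_square[OF assms])
  have "E i j k l = (1/2) *\<^sub>C T + (3/4) *\<^sub>C G"
    unfolding T_def G_def by (rule E_expand[OF assms])
  then have "E i j k l * E i j k l = (1/4) *\<^sub>C (Q + Q - S) - (3/8) *\<^sub>C Q - (3/8) *\<^sub>C Q + (9/16) *\<^sub>C 1"
    by (simp add: algebra_simps cscale_mult_left cscale_mult_right cscale_cscale TT GG TG)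
  moreover have "(3/8) *\<^sub>C Q + (3/8) *\<^sub>C Q = (1/4) *\<^sub>C Q + (1/4) *\<^sub>C Q + (1/4) *\<^sub>C Q"
    by (simp flip: cvec.scale_left_distrib)
  moreover have "(9/16) *\<^sub>C 1 = (3/16) *\<^sub>C 1 + (1/4) *\<^sub>C (3/2) *\<^sub>C (1 :: 'a)"
    by (simp add: cscale_cscale flip: cvec.scale_left_distrib)
  moreover have sum_J: "J i j * J i j + J i k * J i k + J i l * J i l + J j k * J j k + J j l * J j l
      + J k l * J k l = S + Q - (3/2) *\<^sub>C 1"
  proof -
    have "(3/2) *\<^sub>C (1 :: 'a) = (1/4) *\<^sub>C 1 + (1/4) *\<^sub>C 1 + (1/4) *\<^sub>C 1 + (1/4) *\<^sub>C 1 + (1/4) *\<^sub>C 1 + (1/4) *\<^sub>C 1"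
      by (simp only: flip: cvec.scale_left_distrib) simp
    then show ?thesis
      by (simp add: ne[THEN J_square] S_def Q_def algebra_simps)
  qed
  ultimately show ?thesis unfolding sum_J
    by (simp add: algebra_simps cvec.scale_right_distrib cvec.scale_right_diff_distrib)
qed

abbreviation J_prod :: "('n \<times> 'n) list \<Rightarrow> 'a" where
  "J_prod cs \<equiv> prod_list (map (\<lambda>(i, j). J i j) cs)"

text \<open>
  Pairs in either orientation are admitted, since commutators of chord elements naturally produce both.
\<close>
definition filtration :: "nat \<Rightarrow> 'a set" where
  "filtration d = cvec.span {J_prod cs | cs. length cs \<le> d \<and> (\<forall>(i, j)\<in>set cs. i \<noteq> j)}"

lemma filtration_0: "0 \<in> filtration d"
  and filtration_add: "a \<in> filtration d \<Longrightarrow> b \<in> filtration d \<Longrightarrow> a + b \<in> filtration d"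
  and filtration_diff: "a \<in> filtration d \<Longrightarrow> b \<in> filtration d \<Longrightarrow> a - b \<in> filtration d"
  and filtration_minus: "a \<in> filtration d \<Longrightarrow> - a \<in> filtration d"
  and filtration_scale: "a \<in> filtration d \<Longrightarrow> c *\<^sub>C a \<in> filtration d"
  unfolding filtration_def
  by (simp_all add: cvec.span_zero cvec.span_add cvec.span_diff cvec.span_neg cvec.span_scale)

lemma filtration_J_prod: "length cs \<le> d \<Longrightarrow> \<forall>(i, j)\<in>set cs. i \<noteq> j \<Longrightarrow> J_prod cs \<in> filtration d"
  unfolding filtration_def by (rule cvec.span_base) blast

lemma filtration_1: "1 \<in> filtration d"
  using filtration_J_prod[of "[]"] by simp

lemma filtration_J: "i \<noteq> j \<Longrightarrow> J i j \<in> filtration (Suc d)"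
  using filtration_J_prod[of "[(i, j)]"] by simp

lemma filtration_subset:
  assumes "\<And>cs. length cs \<le> d \<Longrightarrow> \<forall>(i, j)\<in>set cs. i \<noteq> j \<Longrightarrow> J_prod cs \<in> V"
    and "cvec.subspace V"
  shows "filtration d \<subseteq> V"
  unfolding filtration_def using assms by (intro cvec.span_minimal) auto

lemma filtration_mono: "a \<in> filtration d \<Longrightarrow> d \<le> d' \<Longrightarrow> a \<in> filtration d'"
  using filtration_subset[of d "filtration d'"] filtration_J_prod
  by (metis (no_types, lifting) cvec.subspace_span filtration_def order_trans subsetD)

text \<open>
  Reduces claims about products and commutators of filtered elements to products of generators.
\<close>
lemma filtration_bilinear:
  assumes "\<And>cs ds. length cs \<le> p \<Longrightarrow> length ds \<le> q \<Longrightarrow> \<forall>(i, j)\<in>set (cs @ ds). i \<noteq> j \<Longrightarrow>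
      f (J_prod cs) (J_prod ds) \<in> filtration r"
    and "\<And>a a' b. f (a + a') b = f a b + f a' b" "\<And>a b b'. f a (b + b') = f a b + f a b'"
    and "\<And>c a b. f (c *\<^sub>C a) b = c *\<^sub>C f a b" "\<And>c a b. f a (c *\<^sub>C b) = c *\<^sub>C f a b"
    and "a \<in> filtration p" "b \<in> filtration q"
  shows "f a b \<in> filtration r"
proof -
  have f0: "f 0 b = 0" "f a 0 = 0" for a b
    using assms(4)[of 0 0 b] assms(5)[of a 0 0] by simp_all
  have 1: "f (J_prod cs) b \<in> filtration r" if "length cs \<le> p" "\<forall>(i, j)\<in>set cs. i \<noteq> j" for cs
  proof -
    have "filtration q \<subseteq> {b. f (J_prod cs) b \<in> filtration r}"
      using that
      by (intro filtration_subset)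
        (auto simp: cvec.subspace_def f0 assms(3,5) filtration_0 filtration_add filtration_scale intro!: assms(1))
    then show ?thesis using assms(7) by auto
  qed
  have "filtration p \<subseteq> {a. f a b \<in> filtration r}"
    using 1
    by (intro filtration_subset) (auto simp: cvec.subspace_def f0 assms(2,4) filtration_0 filtration_add filtration_scale)
  then show ?thesis using assms(6) by auto
qed

lemma filtration_mult:
  assumes "a \<in> filtration p" "b \<in> filtration q" shows "a * b \<in> filtration (p + q)"
  by (rule filtration_bilinear[OF _ _ _ _ _ assms])
    (use filtration_J_prod in \<open>auto simp: distrib_left distrib_right cscale_mult_left cscale_mult_right
      simp flip: prod_list.append map_append\<close>)

lemma J_commutator:
  assumes "i \<noteq> j" "k \<noteq> l" shows "J i j * J k l - J k l * J i j \<in> filtration 1"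
proof -
  have *: "J i j * J j l - J j l * J i j \<in> filtration 1" if "i \<noteq> j" "j \<noteq> l" for i j l
  proof (cases "i = l")
    case True
    then show ?thesis using that J_swap[of i j] by (simp add: filtration_0)
  next
    case False
    then show ?thesis using that J_bracket[of i j l] filtration_J[of i l 0] by simp
  qed
  consider "distinct [i, j, k, l]" | "j = k" | "i = l" | "i = k" | "j = l"
    using assms by auto
  then show ?thesis
  proof cases
    case 1
    then show ?thesis using J_commute[of i j k l] by (simp add: filtration_0)
  next
    case 2
    then show ?thesis using *[of i j l] assms by simp
  next
    case 3
    then show ?thesis using filtration_minus[OF *[of k i j]] assms by simp
  next
    case 4
    then show ?thesis using filtration_minus[OF *[of j i l]] assms J_swap[of i j] by (simp add: algebra_simps)
  next
    case 5
    then show ?thesis using filtration_minus[OF *[of i j k]] assms J_swap[of j k] by (simp add: algebra_simps)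
  qed
qed

lemma J_commutator_list:
  assumes "i \<noteq> j" "\<forall>(i, j)\<in>set cs. i \<noteq> j"
  shows "J i j * J_prod cs - J_prod cs * J i j \<in> filtration (length cs)"
  using assms(2)
proof (induction cs)
  case (Cons c cs)
  obtain k l where c: "c = (k, l)" by (cases c)
  have "(J i j * J k l - J k l * J i j) * J_prod cs \<in> filtration (1 + length cs)"
    using Cons.prems by (intro filtration_mult J_commutator filtration_J_prod) (auto simp: c assms)
  moreover have "J k l * (J i j * J_prod cs - J_prod cs * J i j) \<in> filtration (Suc 0 + length cs)"
    using Cons by (intro filtration_mult filtration_J) (auto simp: c)
  ultimately show ?case
    using filtration_add by (fastforce simp: c algebra_simps)
qed (simp add: filtration_0)

lemma J_prod_permute:
  assumes "mset cs = mset ds" "\<forall>(i, j)\<in>set cs. i \<noteq> j"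
  shows "J_prod cs - J_prod ds \<in> filtration (length cs - 1)"
  using assms
proof (induction cs arbitrary: ds)
  case (Cons c cs)
  obtain k l where c: "c = (k, l)" by (cases c)
  have "c \<in> set ds" using Cons.prems by (metis list.set_intros(1) set_mset_mset)
  then obtain u v where ds: "ds = u @ c # v" by (meson split_list)
  have m: "mset cs = mset (u @ v)" using Cons.prems by (simp add: ds)
  then have sets: "set cs = set u \<union> set v" and len: "length cs = length u + length v"
    by (metis set_append set_mset_mset, metis length_append size_mset)
  have kl: "k \<noteq> l" using Cons.prems by (auto simp: c)
  have "J k l * (J_prod cs - J_prod (u @ v)) \<in> filtration (length cs)"
  proof (cases "cs = []")
    case False
    have "J k l * (J_prod cs - J_prod (u @ v)) \<in> filtration (Suc 0 + (length cs - 1))"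
      using Cons.prems m kl by (intro filtration_mult filtration_J Cons.IH) auto
    with False show ?thesis by simp
  qed (use m in \<open>simp add: filtration_0\<close>)
  moreover have "(J k l * J_prod u - J_prod u * J k l) * J_prod v \<in> filtration (length u + length v)"
    using Cons.prems kl by (intro filtration_mult J_commutator_list filtration_J_prod) (auto simp: sets)
  ultimately have "J k l * (J_prod cs - J_prod (u @ v)) + (J k l * J_prod u - J_prod u * J k l) * J_prod v
      \<in> filtration (length cs)"
    unfolding len by (rule filtration_add)
  then show ?case by (simp add: c ds algebra_simps)
qed (simp add: filtration_0)

text \<open>
  The associated graded algebra is commutative, as generators commute up to generators.
\<close>
lemma filtration_commutator:
  assumes "a \<in> filtration p" "b \<in> filtration q" shows "a * b - b * a \<in> filtration (p + q - 1)"
proof (rule filtration_bilinear[OF _ _ _ _ _ assms])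
  fix cs ds :: "('n \<times> 'n) list"
  assume "length cs \<le> p" "length ds \<le> q" "\<forall>(i, j)\<in>set (cs @ ds). i \<noteq> j"
  then show "J_prod cs * J_prod ds - J_prod ds * J_prod cs \<in> filtration (p + q - 1)"
    using filtration_mono[OF J_prod_permute[of "cs @ ds" "ds @ cs"], of "p + q - 1"] by simp
qed (simp_all add: algebra_simps cscale_mult_left cscale_mult_right cvec.scale_right_diff_distrib)

lemma E_filtration: "distinct [i, j, k, l] \<Longrightarrow> E i j k l \<in> filtration 2"
  unfolding E_def using filtration_mult[OF filtration_J[of _ _ 0] filtration_J[of _ _ 0]]
  by (intro filtration_add filtration_diff) (simp_all add: numeral_2_eq_2)

lemma E_square_filtration: "distinct [i, j, k, l] \<Longrightarrow> E i j k l * E i j k l \<in> filtration 2"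
  unfolding E_square using filtration_mult[OF filtration_J[of _ _ 0] filtration_J[of _ _ 0]]
  by (intro filtration_add filtration_diff filtration_scale filtration_1) (simp_all add: numeral_2_eq_2)

text \<open>
  Write \<open>A\<close>, \<open>B\<close> for the two factors and \<open>P = J p q\<close>. As \<open>[P, A] = - B\<close>, the commutator \<open>[P, A\<^sup>2]\<close> is \<open>- (A B + B A)\<close>,
  and it has degree two because \<open>A\<^sup>2\<close> does. The antisymmetric part \<open>A B - B A\<close> is a commutator of elements of
  degree two, hence of degree three.
\<close>
lemma E_mixed_filtration:
  assumes "distinct [i, j, k, p, q]"
  shows "E i j k p * E i j k q \<in> filtration 3"
proof -
  define A B P where "A = E i j k p" and "B = E i j k q" and "P = J p q"
  have c: "P * J i j = J i j * P" "P * J i k = J i k * P" "P * J j k = J j k * P"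
    using J_commute[of i j p q] J_commute[of i k p q] J_commute[of j k p q] assms
    by (simp_all add: P_def)
  have b: "P * J k p = J k p * P - J k q" "P * J j p = J j p * P - J j q" "P * J i p = J i p * P - J i q"
    using J_bracket[of k p q] J_bracket[of j p q] J_bracket[of i p q] assms
    by (simp_all add: P_def)
  have left: "a * b = c \<Longrightarrow> a * (b * z) = c * z" for a b c z :: 'a by (simp flip: mult.assoc)
  have PA: "P * A = A * P - B"
    by (simp add: A_def B_def E_def algebra_simps b c b[THEN left] c[THEN left])
  have A: "A \<in> filtration 2" "A * A \<in> filtration 2" and B: "B \<in> filtration 2"
    using assms by (simp_all add: A_def B_def E_filtration E_square_filtration)
  have P: "P \<in> filtration 1"
    using filtration_J[of p q 0] assms by (simp add: P_def)
  have "P * (A * A) - (A * A) * P = - (A * B + B * A)"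
    by (simp add: PA PA[THEN left] algebra_simps)
  then have "A * B + B * A \<in> filtration 2"
    using filtration_minus[OF filtration_commutator[OF P A(2)]] by (simp add: add.commute numeral_2_eq_2)
  then have "A * B + B * A \<in> filtration 3" by (rule filtration_mono) simp
  moreover have "A * B - B * A \<in> filtration 3"
    using filtration_commutator[OF A(1) B] by simp
  ultimately have "(1/2) *\<^sub>C ((A * B + B * A) + (A * B - B * A)) \<in> filtration 3"
    by (rule filtration_scale[OF filtration_add])
  moreover have "(A * B + B * A) + (A * B - B * A) = A * B + A * B" by simp
  ultimately show ?thesis by (simp only: half_double A_def B_def)
qed

lemma E_permute:
  assumes "distinct [i, j, k, l]" "distinct [i', j', k', l']" "{i', j', k', l'} = {i, j, k, l}"
  shows "E i' j' k' l' = E i j k l \<or> E i' j' k' l' = - E i j k l"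
proof -
  have ne: "i \<noteq> j" "i \<noteq> k" "i \<noteq> l" "j \<noteq> k" "j \<noteq> l" "k \<noteq> l" using assms(1) by auto
  have "distinct [i, j, k, l]" "distinct [i, k, j, l]" "distinct [i, l, j, k]" using ne by auto
  note r = ne[THEN J_swap] this[THEN J_commute, symmetric]
  have mem: "i' \<in> {i, j, k, l}" "j' \<in> {i, j, k, l}" "k' \<in> {i, j, k, l}" "l' \<in> {i, j, k, l}"
    using assms(3) by blast+
  show ?thesis
    using mem(1)
    apply (elim insertE emptyE; hypsubst)
    using mem(2-4) assms(2)
       apply (elim insertE emptyE; simp add: E_def r algebra_simps)+
    done
qed

text \<open>
  On at most five vertices two index sets of size four are equal or share exactly three elements;
  up to sign the ordering of the indices of \<open>E\<close> is irrelevant.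
\<close>
lemma E_product_filtration:
  assumes fin: "finite (UNIV :: 'n set)" and n: "card (UNIV :: 'n set) \<le> 5"
    and a: "distinct [i, j, k, l]" and b: "distinct [i', j', k', l']"
  shows "E i j k l * E i' j' k' l' \<in> filtration 3"
proof -
  define A B where "A = {i, j, k, l}" and "B = {i', j', k', l'}"
  have cards: "card A = 4" "card B = 4" and AB: "finite A" "finite B"
    using a b by (simp_all add: A_def B_def)
  have sign: "x * y \<in> filtration 3" if "x' * y' \<in> filtration 3" "x = x' \<or> x = - x'" "y = y' \<or> y = - y'" for x y x' y'
    using that filtration_minus by auto
  show ?thesis
  proof (cases "B = A")
    case True
    have "E i j k l * E i j k l \<in> filtration 3"
      by (rule filtration_mono[OF E_square_filtration[OF a]]) simp
    from sign[OF this disjI1[OF refl] E_permute[OF a b]] True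
    show ?thesis by (simp add: A_def B_def)
  next
    case False
    have "card (A \<union> B) \<le> 5" using card_mono[OF fin, of "A \<union> B"] n by simp
    moreover have "card A + card B = card (A \<union> B) + card (A \<inter> B)"
      using AB by (rule card_Un_Int)
    moreover have "\<not> A \<subseteq> B"
      using card_subset_eq[of B A] cards AB False by auto
    then have "card (A \<inter> B) < card A"
      using AB by (intro psubset_card_mono) blast+
    ultimately have c3: "card (A \<inter> B) = 3" using cards by linarith
    then obtain s1 s2 s3 where s: "A \<inter> B = {s1, s2, s3}" "distinct [s1, s2, s3]"
      by (auto simp: card_3_iff)
    have "card (A - B) = 1" "card (B - A) = 1"
      using cards c3 AB card_Diff_subset_Int[of A B] card_Diff_subset_Int[of B A]
      by (simp_all add: Int_commute)
    then obtain p q where pq: "A - B = {p}" "B - A = {q}" by (metis card_1_singletonE)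
    have "s1 \<in> A \<inter> B" "s2 \<in> A \<inter> B" "s3 \<in> A \<inter> B" "p \<in> A - B" "q \<in> B - A"
      using s(1) pq by simp_all
    then have dist: "distinct [s1, s2, s3, p, q]"
      using s(2) by auto
    have "A = (A \<inter> B) \<union> (A - B)" "B = (A \<inter> B) \<union> (B - A)" by blast+
    then have "{s1, s2, s3, p} = A" "{s1, s2, s3, q} = B" unfolding s(1) pq by auto
    then have "E i j k l = E s1 s2 s3 p \<or> E i j k l = - E s1 s2 s3 p"
      "E i' j' k' l' = E s1 s2 s3 q \<or> E i' j' k' l' = - E s1 s2 s3 q"
      unfolding A_def B_def using dist by (intro E_permute a b; simp)+
    then show ?thesis by (rule sign[OF E_mixed_filtration[OF dist]])
  qed
qed

end


section \<open>Spanning by uncrossable monomials\<close>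

lemma tensor_mult: "(a \<otimes> b) * (a' \<otimes> b') = (a * a') \<otimes> (b * b')"
  by (simp add: tensor_of_def times_tensor.abs_eq pure_mult)

lemma tensor_one: "1 \<otimes> 1 = 1"
  by (simp add: tensor_of_def one_tensor_def pure_def zero_prod_monoid_def flip: single_one)

lemma tensor_add_left: "(a + a') \<otimes> b = a \<otimes> b + a' \<otimes> b"
  and tensor_add_right: "a \<otimes> (b + b') = a \<otimes> b + a \<otimes> b'"
  by (transfer, rule pm.span_base, unfold bilinear_relators_def diff_diff_add[symmetric], blast)+

lemma weyl_commutator: "weyl_y i * weyl_x j = weyl_x j * weyl_y i + (if i = j then 1 else 0)"
proof -
  have "weyl_y i * weyl_x j - weyl_x j * weyl_y i - (if i = j then 1 else 0) = 0"
    by (cases "i = j"; simp; transfer; auto simp: weyl_relators_def intro!: generated_ideal.gen)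
  then show ?thesis by (simp add: algebra_simps)
qed

lemma weyl_x_commute: "weyl_x i * weyl_x j = weyl_x j * weyl_x i"
  and weyl_y_commute: "weyl_y i * weyl_y j = weyl_y j * weyl_y i"
  by (transfer; auto simp: weyl_relators_def intro!: generated_ideal.gen)+

lemma clifford_anticommute:
  "clifford_e i * clifford_e j + clifford_e j * clifford_e i = (if i = j then 1 + 1 else 0)"
proof -
  have "clifford_e i * clifford_e j + clifford_e j * clifford_e i - (if i = j then 1 + 1 else 0) = 0"
    by (cases "i = j"; simp; transfer;
        auto simp: clifford_relators_def simp flip: one_add_one intro!: generated_ideal.gen)
  then show ?thesis by simp
qed

lemma tensor_zero_right: "a \<otimes> 0 = 0" and tensor_zero_left: "0 \<otimes> b = 0"
  using tensor_add_right[of a 0 0] tensor_add_left[of 0 0 b] by simp_all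

lemma weyl_clifford_tensor:
  "weyl_clifford (\<lambda>i. weyl_x i \<otimes> 1) (\<lambda>i. weyl_y i \<otimes> 1) (\<lambda>i. (1 :: 'n weyl) \<otimes> clifford_e i)"
proof
  fix i j :: 'n
  show "(weyl_y i \<otimes> 1) * (weyl_x j \<otimes> 1) = (weyl_x j \<otimes> 1) * (weyl_y i \<otimes> 1) + (if i = j then 1 else 0)"
    by (simp add: tensor_mult weyl_commutator tensor_add_left tensor_one tensor_zero_left)
  show "((1 :: 'n weyl) \<otimes> clifford_e i) * (1 \<otimes> clifford_e j) + (1 \<otimes> clifford_e j) * (1 \<otimes> clifford_e i)
      = (if i = j then 1 + 1 else 0)"
    by (simp add: tensor_mult clifford_anticommute flip: tensor_add_right)
      (simp add: tensor_zero_right tensor_add_right tensor_one)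
qed (simp_all add: tensor_mult weyl_x_commute weyl_y_commute)

lemma J_eq_Oel:
  "weyl_clifford.J (\<lambda>i. weyl_x i \<otimes> 1) (\<lambda>i. weyl_y i \<otimes> 1) (\<lambda>i. 1 \<otimes> clifford_e i) = Oel"
  by (intro ext)
    (simp add: weyl_clifford.J_def[OF weyl_clifford_tensor] weyl_clifford.L_def[OF weyl_clifford_tensor]
      Oel_def tensor_mult)

interpretation tensor: weyl_clifford "\<lambda>i. weyl_x i \<otimes> 1" "\<lambda>i. weyl_y i \<otimes> 1"
    "\<lambda>i. 1 \<otimes> clifford_e i"
  rewrites "weyl_clifford.J (\<lambda>i. weyl_x i \<otimes> 1) (\<lambda>i. weyl_y i \<otimes> 1) (\<lambda>i. 1 \<otimes> clifford_e i) = Oel"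
  by (rule weyl_clifford_tensor) (rule J_eq_Oel)

definition chord_list :: "('n::{finite,linorder} \<times> 'n) rel \<Rightarrow> ('n \<times> 'n) multiset \<Rightarrow> ('n \<times> 'n) list" where
  "chord_list r D = concat (map (\<lambda>c. replicate (count D c) c) (increasing_list r chords))"

lemma mset_concat_replicate:
  "distinct cs \<Longrightarrow> mset (concat (map (\<lambda>c. replicate (count D c) c) cs)) = filter_mset (\<lambda>c. c \<in> set cs) D"
proof (induction cs)
  case (Cons c cs)
  have "filter_mset (\<lambda>d. d \<in> set (c # cs)) D = filter_mset (\<lambda>d. d = c) D + filter_mset (\<lambda>d. d \<in> set cs) D"
    using Cons.prems by (intro multiset_eqI) auto
  with Cons show ?case by (simp add: filter_eq_replicate_mset eq_commute)
qed simp

lemma mset_chord_list: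
  assumes "linear_order_on (chords :: ('n::{finite,linorder} \<times> 'n) set) r" "diagram D"
  shows "mset (chord_list r D) = D"
proof -
  let ?P = "\<lambda>xs. distinct xs \<and> set xs = (chords :: ('n \<times> 'n) set) \<and> sorted_wrt (\<lambda>a b. (a, b) \<in> r) xs"
  have "?P (increasing_list r chords)"
    unfolding increasing_list_def by (rule theI'[OF increasing_list_unique]) (use assms(1) in auto)
  then show ?thesis
    using assms(2)
    by (auto simp: chord_list_def mset_concat_replicate diagram_def filter_mset_eq_conv)
qed

lemma ordered_monomial_eq: "ordered_monomial r D = Oel_prod (chord_list r D)"
proof -
  have "Oel_prod (concat (map (\<lambda>c. replicate (count D c) c) cs)) =
    prod_list (map (\<lambda>(i, j). Oel i j ^ count D (i, j)) cs)" for cs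
    by (induction cs) (auto simp: prod_list_replicate)
  then show ?thesis by (simp add: ordered_monomial_def chord_list_def)
qed

text \<open>
  With \<open>p\<close>, \<open>p'\<close> the two crossing products, \<open>q\<close>, \<open>q'\<close> their uncrossed replacements, and
  \<open>p = q - E\<close>, \<open>p' = q' - E'\<close>, one has \<open>p p' = p q' + q p' - q q' + E E'\<close>. The first three terms have smaller weight,
  since every summand replaces at least one crossing, and \<open>E E'\<close> has degree three instead of four.
\<close>
lemma chord_products_in_span:
  fixes r :: "('n::{finite,linorder} \<times> 'n) rel"
  assumes n: "card (UNIV :: 'n set) \<le> 5" and r: "linear_order_on (chords :: ('n \<times> 'n) set) r"
  defines "V \<equiv> cvec.span (ordered_monomial r ` {D. uncrossable D})"
  assumes lower: "\<And>d. Suc d = length cs \<Longrightarrow> tensor.filtration d \<subseteq> V" and cs: "set cs \<subseteq> chords"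
  shows "Oel_prod cs \<in> V"
  using cs lower
proof (induction "weight (mset cs)" arbitrary: cs rule: less_induct)
  case less
  have V_add: "a \<in> V \<Longrightarrow> b \<in> V \<Longrightarrow> a + b \<in> V" and V_diff: "a \<in> V \<Longrightarrow> b \<in> V \<Longrightarrow> a - b \<in> V" for a b
    unfolding V_def by (rule cvec.span_add cvec.span_diff; assumption)+
  have proper: "\<forall>(i, j)\<in>set cs. i \<noteq> j" if "set cs \<subseteq> chords" for cs :: "('n \<times> 'n) list"
    using that by (auto simp: chords_def)
  have permute: "Oel_prod cs \<in> V" if "mset cs = mset ds" "Oel_prod ds \<in> V" for ds
  proof (cases "length cs")
    case 0
    then show ?thesis using that by simp
  next
    case (Suc d)
    then have "Oel_prod cs - Oel_prod ds \<in> tensor.filtration d"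
      using tensor.J_prod_permute[OF that(1) proper[OF less.prems(1)]] by simp
    then have "Oel_prod cs - Oel_prod ds \<in> V" using less.prems(2)[of d] Suc by auto
    then show ?thesis using V_add[OF _ that(2)] by fastforce
  qed
  show ?case
  proof (cases "uncrossable (mset cs)")
    case True
    have "Oel_prod (chord_list r (mset cs)) \<in> V"
      unfolding V_def ordered_monomial_eq[symmetric] using True by (intro cvec.span_base) auto
    then show ?thesis
      using permute[of "chord_list r (mset cs)"] mset_chord_list[OF r] True
      by (auto simp: uncrossable_def)
  next
    case False
    have dia: "diagram (mset cs)" using less.prems(1) by (simp add: diagram_def)
    obtain c1 c2 c3 c4 where c: "crossing c1 c2" "crossing c3 c4" "{#c1, c2, c3, c4#} \<subseteq># mset cs"
      using not_uncrossable_two_crossings[OF n dia False] by metis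
    obtain i j k l where a: "i < j" "j < k" "k < l" "{#c1, c2#} = {#(i, k), (j, l)#}"
      using c(1) by (auto simp: crossing_def)
    obtain i' j' k' l' where b: "i' < j'" "j' < k'" "k' < l'" "{#c3, c4#} = {#(i', k'), (j', l')#}"
      using c(2) by (auto simp: crossing_def)
    obtain R where "mset cs = {#c1, c2#} + {#c3, c4#} + R"
      using c(3) by (auto simp: mset_subset_eq_exists_conv)
    then have "mset cs = {#(i, k), (j, l), (i', k'), (j', l')#} + R" by (simp only: a(4) b(4)) simp
    moreover obtain rs where "R = mset rs" by (metis ex_mset)
    ultimately have cs: "mset cs = mset ([(i, k), (j, l), (i', k'), (j', l')] @ rs)" by simp
    then have len: "length cs = 4 + length rs" using arg_cong[OF cs, of size] unfolding size_mset by simp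
    have rs: "set rs \<subseteq> chords" using less.prems(1) mset_eq_setD[OF cs] by auto
    note wa = weight_uncross[OF a(1-3)] and wb = weight_uncross[OF b(1-3)]
    have smaller: "Oel_prod (ds @ rs) \<in> V"
      if "length ds = 4" "set ds \<subseteq> chords" "weight (mset ds) < weight {#(i, k), (j, l), (i', k'), (j', l')#}" for ds
    proof (rule less.hyps)
      show "weight (mset (ds @ rs)) < weight (mset cs)" using that(3) unfolding cs by simp
      show "set (ds @ rs) \<subseteq> chords" using that(2) rs by simp
      show "tensor.filtration d \<subseteq> V" if "Suc d = length (ds @ rs)" for d
        using that \<open>length ds = 4\<close> len by (intro less.prems(2)) simp
    qed
    have ch: "(i, j) \<in> chords" "(k, l) \<in> chords" "(i, k) \<in> chords" "(j, l) \<in> chords" "(i, l) \<in> chords" "(j, k) \<in> chords"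
      "(i', j') \<in> chords" "(k', l') \<in> chords" "(i', k') \<in> chords" "(j', l') \<in> chords" "(i', l') \<in> chords" "(j', k') \<in> chords"
      using a b by (auto simp: chords_def)
    define p q p' q' E E' where "p = Oel i k * Oel j l" and "q = Oel i j * Oel k l + Oel i l * Oel j k"
      and "p' = Oel i' k' * Oel j' l'" and "q' = Oel i' j' * Oel k' l' + Oel i' l' * Oel j' k'"
      and "E = tensor.E i j k l" and "E' = tensor.E i' j' k' l'"
    have pE: "p = q - E" "p' = q' - E'"
      by (simp_all add: p_def q_def p'_def q'_def E_def E'_def tensor.E_def)
    have "(p * q') * Oel_prod rs = Oel_prod ([(i, k), (j, l), (i', j'), (k', l')] @ rs)
        + Oel_prod ([(i, k), (j, l), (i', l'), (j', k')] @ rs)"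
      by (simp add: p_def q'_def algebra_simps)
    also have "\<dots> \<in> V"
      using wb ch by (intro V_add smaller) simp_all
    finally have 1: "(p * q') * Oel_prod rs \<in> V" .
    have "(q * p') * Oel_prod rs = Oel_prod ([(i, j), (k, l), (i', k'), (j', l')] @ rs)
        + Oel_prod ([(i, l), (j, k), (i', k'), (j', l')] @ rs)"
      by (simp add: q_def p'_def algebra_simps)
    also have "\<dots> \<in> V"
      using wa ch by (intro V_add smaller) simp_all
    finally have 2: "(q * p') * Oel_prod rs \<in> V" .
    have "(q * q') * Oel_prod rs = Oel_prod ([(i, j), (k, l), (i', j'), (k', l')] @ rs)
        + Oel_prod ([(i, j), (k, l), (i', l'), (j', k')] @ rs)
        + Oel_prod ([(i, l), (j, k), (i', j'), (k', l')] @ rs)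
        + Oel_prod ([(i, l), (j, k), (i', l'), (j', k')] @ rs)"
      by (simp add: q_def q'_def algebra_simps)
    also have "\<dots> \<in> V"
      using wa wb ch by (intro V_add smaller) simp_all
    finally have 3: "(q * q') * Oel_prod rs \<in> V" .
    have "E * E' \<in> tensor.filtration 3"
      unfolding E_def E'_def using a b n by (intro tensor.E_product_filtration) auto
    then have "(E * E') * Oel_prod rs \<in> tensor.filtration (3 + length rs)"
      by (intro tensor.filtration_mult tensor.filtration_J_prod proper rs order_refl)
    then have 4: "(E * E') * Oel_prod rs \<in> V"
      using less.prems(2)[of "3 + length rs"] len by auto
    have "Oel_prod ([(i, k), (j, l), (i', k'), (j', l')] @ rs) = (p * p') * Oel_prod rs"
      by (simp add: p_def p'_def mult.assoc)
    also have "\<dots> = (p * q') * Oel_prod rs + (q * p') * Oel_prod rs - (q * q') * Oel_prod rs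
        + (E * E') * Oel_prod rs"
      unfolding pE by (simp add: algebra_simps)
    also have "\<dots> \<in> V" by (intro V_add V_diff 1 2 3 4)
    finally show ?thesis by (rule permute[OF cs])
  qed
qed

text \<open>
  Reversing a pair only changes the sign, so products over chords suffice.
\<close>
lemma filtration_in_span:
  fixes r :: "('n::{finite,linorder} \<times> 'n) rel"
  assumes n: "card (UNIV :: 'n set) \<le> 5" and r: "linear_order_on (chords :: ('n \<times> 'n) set) r"
  shows "tensor.filtration d \<subseteq> cvec.span (ordered_monomial r ` {D. uncrossable D})" (is "_ \<subseteq> ?V")
proof (induction d rule: less_induct)
  case (less d)
  show ?case
  proof (rule tensor.filtration_subset)
    fix cs :: "('n \<times> 'n) list"
    assume cs: "length cs \<le> d" "\<forall>(i, j)\<in>set cs. i \<noteq> j"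
    define orient where "orient = (\<lambda>(i :: 'n, j). if i < j then (i, j) else (j, i))"
    have sign: "Oel_prod cs = Oel_prod (map orient cs) \<or> Oel_prod cs = - Oel_prod (map orient cs)"
      using cs(2)
    proof (induction cs)
      case (Cons c cs)
      obtain i j where c: "c = (i, j)" by (cases c)
      with Cons show ?case using tensor.J_swap[of i j] by (auto simp: orient_def not_less)
    qed simp
    have "Oel_prod (map orient cs) \<in> ?V"
    proof (rule chord_products_in_span[OF n r])
      show "tensor.filtration d' \<subseteq> ?V" if "Suc d' = length (map orient cs)" for d'
        using that cs(1) by (intro less) simp
      show "set (map orient cs) \<subseteq> chords" 
      proof -
        have "orient c \<in> chords" if "fst c \<noteq> snd c" for c
          using that by (cases c) (auto simp: orient_def chords_def)
        then show ?thesis using cs(2) by fastforce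
      qed
    qed
    then show "Oel_prod cs \<in> ?V" using sign cvec.span_neg by auto
  qed (rule cvec.subspace_span)
qed

lemma generated_subalgebra_closed:
  shows "0 \<in> generated_subalgebra S"
    and "(\<And>x. x \<in> set xs \<Longrightarrow> x \<in> generated_subalgebra S) \<Longrightarrow> prod_list xs \<in> generated_subalgebra S"
proof -
  show "0 \<in> generated_subalgebra S"
    using generated_subalgebra.scale[OF generated_subalgebra.one, of 0] by simp
  show "(\<And>x. x \<in> set xs \<Longrightarrow> x \<in> generated_subalgebra S) \<Longrightarrow> prod_list xs \<in> generated_subalgebra S"
    by (induction xs) (auto intro: generated_subalgebra.intros)
qed

text \<open>
  The filtration is exhaustive.
\<close>
lemma generated_subalgebra_subset_filtration:
  "generated_subalgebra {Oel i j | i j :: 'n::linorder. i < j} \<subseteq> (\<Union>d. tensor.filtration d)"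
proof
  fix a assume "a \<in> generated_subalgebra {Oel i j | i j :: 'n. i < j}"
  then show "a \<in> (\<Union>d. tensor.filtration d)"
  proof induction
    case (gen s)
    then obtain i j :: 'n where "i < j" "s = Oel i j" by auto
    then have "s \<in> tensor.filtration (Suc 0)" using tensor.filtration_J[of i j 0] by simp
    then show ?case by blast
  next
    case one
    show ?case using tensor.filtration_1 by auto
  next
    case (add a b)
    then obtain p q where "a \<in> tensor.filtration p" "b \<in> tensor.filtration q" by auto
    then have "a + b \<in> tensor.filtration (p + q)"
      by (intro tensor.filtration_add) (rule tensor.filtration_mono, assumption, simp)+
    then show ?case by blast
  next
    case (mult a b)
    then obtain p q where "a \<in> tensor.filtration p" "b \<in> tensor.filtration q" by auto
    then have "a * b \<in> tensor.filtration (p + q)" by (rule tensor.filtration_mult)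
    then show ?case by blast
  next
    case (scale a c)
    then obtain p where "a \<in> tensor.filtration p" by auto
    then have "c *\<^sub>C a \<in> tensor.filtration p" by (rule tensor.filtration_scale)
    then show ?case by blast
  qed
qed

theorem theorem5p6:
  fixes r :: "('n::{finite,linorder} \<times> 'n) rel"
  assumes "card (UNIV :: 'n set) \<in> {4, 5}"
    and "linear_order_on (chords :: ('n \<times> 'n) set) r"
  shows "inj_on (ordered_monomial r) {D. uncrossable D} \<and>
    cvec.independent (ordered_monomial r ` {D. uncrossable D}) \<and>
    cvec.span (ordered_monomial r ` {D. uncrossable D}) =
      generated_subalgebra {Oel i j | i j :: 'n. i < j}"
proof (intro conjI)
  let ?G = "generated_subalgebra {Oel i j | i j :: 'n. i < j}"
  have indep: "\<forall>D\<in>\<D>. a D = 0"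
    if "finite \<D>" "\<D> \<subseteq> {D. uncrossable D}" "(\<Sum>D\<in>\<D>. a D *\<^sub>C ordered_monomial r D) = 0" for \<D> a
    using that mset_chord_list[OF assms(2)]
    by (intro uncrossable_products_independent[of _ "chord_list r"])
      (auto simp: ordered_monomial_eq uncrossable_def)
  show inj: "inj_on (ordered_monomial r) {D. uncrossable D}"
  proof (rule inj_onI, rule ccontr)
    fix D D' assume D: "D \<in> {D. uncrossable D}" "D' \<in> {D. uncrossable D}"
      "ordered_monomial r D = ordered_monomial r D'" "D \<noteq> D'"
    from indep[of "{D, D'}" "\<lambda>C. if C = D then 1 else - 1"] D show False
      by (simp add: cvec.scale_minus_left)
  qed
  show "cvec.independent (ordered_monomial r ` {D. uncrossable D})"
    unfolding cvec.dependent_explicit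
  proof clarify
    fix T u v
    assume T: "finite T" "T \<subseteq> ordered_monomial r ` {D. uncrossable D}" "(\<Sum>v\<in>T. u v *\<^sub>C v) = 0"
      and v: "v \<in> T" "u v \<noteq> 0"
    define \<D> where "\<D> = {D. uncrossable D \<and> ordered_monomial r D \<in> T}"
    have image: "ordered_monomial r ` \<D> = T" using T(2) by (auto simp: \<D>_def)
    have inj_D: "inj_on (ordered_monomial r) \<D>" by (rule inj_on_subset[OF inj]) (auto simp: \<D>_def)
    have "\<forall>D\<in>\<D>. u (ordered_monomial r D) = 0"
    proof (rule indep)
      show "finite \<D>" using T(1) inj_D image by (metis finite_imageD)
      show "(\<Sum>D\<in>\<D>. u (ordered_monomial r D) *\<^sub>C ordered_monomial r D) = 0"
        using T(3) unfolding image[symmetric] by (simp add: sum.reindex[OF inj_D])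
    qed (auto simp: \<D>_def)
    then show False using v image by auto
  qed
  show "cvec.span (ordered_monomial r ` {D. uncrossable D}) = ?G"
  proof
    have "cvec.subspace ?G"
      by (auto simp: cvec.subspace_def generated_subalgebra_closed intro: generated_subalgebra.intros)
    moreover have "ordered_monomial r D \<in> ?G" if "uncrossable D" for D
    proof -
      have "set (chord_list r D) \<subseteq> chords"
        using mset_chord_list[OF assms(2), of D] that
        by (auto simp: uncrossable_def diagram_def simp flip: set_mset_mset)
      then show ?thesis
        unfolding ordered_monomial_eq
        by (intro generated_subalgebra_closed) (auto simp: chords_def intro!: generated_subalgebra.gen)
    qed
    ultimately show "cvec.span (ordered_monomial r ` {D. uncrossable D}) \<subseteq> ?G"
      by (intro cvec.span_minimal) auto
    show "?G \<subseteq> cvec.span (ordered_monomial r ` {D. uncrossable D})"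
    proof -
      have "card (UNIV :: 'n set) \<le> 5" using assms(1) by auto
      then have "(\<Union>d. tensor.filtration d) \<subseteq> cvec.span (ordered_monomial r ` {D. uncrossable D})"
        by (intro UN_least filtration_in_span assms(2))
      then show ?thesis using generated_subalgebra_subset_filtration by (rule order_trans[rotated])
    qed
  qed
qed

end
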